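(* Let $\Lambda=(\lambda_n)_{n\in\mathbb N}$ be a lacunary sequence and let $\mu$ be a positive finite measure on $[0,1)$. Assume that $\mu$ satisfies $(b_p)$ for some $p\in[1,+\infty)$, i.e. $\lim_{n\to+\infty}\lambda_n\int_{[0,1)}t^{p\lambda_n}d\mu=0$. Then $i_\mu^q$ is compact for any $q>p$.
   Context: A sequence $(\lambda_n)_n$ of positive numbers is lacunary if there exists $r>1$ such that $\lambda_{n+1}\ge r\lambda_n$ for every $n$. $M_\Lambda^q$ is the closed linear span of the monomials $t^{\lambda_n}$ in $L^q([0,1],m)$, $m$ the Lebesgue measure; by the Clarkson–Erdős theorem every $f\in M_\Lambda^q$ has well-defined values $f(x)=\sum_na_nx^{\lambda_n}$ at each $x\in[0,1)$. $i_\mu^q:M_\Lambda^q\to L^q(\mu)$ is the embedding $f\mapsto f$. *)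

theory Defs
  imports "HOL-Analysis.Analysis"
begin

section \<open>The spaces \<open>L\<^sup>p(M)\<close>\<close>

text \<open>
  Scalar-valued functions are taken in an arbitrary type of sort
  \<open>{real_normed_field, euclidean_space}\<close>, which has both \<^typ>\<open>real\<close> and \<^typ>\<open>complex\<close> as
  instances. Elements of \<open>L\<^sup>p(M)\<close> are classes of functions modulo equality almost everywhere.
\<close>

definition Lp_functions ::
    "real \<Rightarrow> 'b measure \<Rightarrow> ('b \<Rightarrow> 'a::{real_normed_field, euclidean_space}) set" where
  "Lp_functions p M = {f \<in> borel_measurable M. integrable M (\<lambda>x. norm (f x) powr p)}"

definition Lp_seminorm ::
    "real \<Rightarrow> 'b measure \<Rightarrow> ('b \<Rightarrow> 'a::{real_normed_field, euclidean_space}) \<Rightarrow> real" where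
  "Lp_seminorm p M f = (\<integral>x. norm (f x) powr p \<partial>M) powr (1 / p)"

definition Lp_class ::
    "real \<Rightarrow> 'b measure \<Rightarrow> ('b \<Rightarrow> 'a::{real_normed_field, euclidean_space}) \<Rightarrow> ('b \<Rightarrow> 'a) set" where
  "Lp_class p M f = {g \<in> Lp_functions p M. AE x in M. g x = f x}"

definition Lp_space ::
    "real \<Rightarrow> 'b measure \<Rightarrow> ('b \<Rightarrow> 'a::{real_normed_field, euclidean_space}) set set" where
  "Lp_space p M = Lp_class p M ` Lp_functions p M"

text \<open>Norm and distance do not depend on the representatives; see \<open>Lp_norm_class\<close> and
  \<open>Lp_dist_class\<close> below.\<close>

definition Lp_norm ::
    "real \<Rightarrow> 'b measure \<Rightarrow> ('b \<Rightarrow> 'a::{real_normed_field, euclidean_space}) set \<Rightarrow> real" where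
  "Lp_norm p M F = Lp_seminorm p M (SOME f. f \<in> F)"

definition Lp_dist ::
    "real \<Rightarrow> 'b measure \<Rightarrow> ('b \<Rightarrow> 'a::{real_normed_field, euclidean_space}) set \<Rightarrow> ('b \<Rightarrow> 'a) set \<Rightarrow> real" where
  "Lp_dist p M F G = Lp_seminorm p M (\<lambda>x. (SOME f. f \<in> F) x - (SOME g. g \<in> G) x)"

definition Lp_topology ::
    "real \<Rightarrow> 'b measure \<Rightarrow> ('b \<Rightarrow> 'a::{real_normed_field, euclidean_space}) set topology" where
  "Lp_topology p M = Metric_space.mtopology (Lp_space p M) (Lp_dist p M)"

lemma Lp_functionsD:
  assumes "f \<in> Lp_functions p M"
  shows "f \<in> borel_measurable M" "integrable M (\<lambda>x. norm (f x) powr p)"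
  using assms by (auto simp: Lp_functions_def)

lemma Lp_class_self: "f \<in> Lp_functions p M \<Longrightarrow> f \<in> Lp_class p M f"
  by (simp add: Lp_class_def)

lemma Lp_class_some:
  assumes "f \<in> Lp_functions p M"
  shows "(SOME g. g \<in> Lp_class p M f) \<in> Lp_functions p M"
    and "AE x in M. (SOME g. g \<in> Lp_class p M f) x = f x"
  using someI[of "\<lambda>g. g \<in> Lp_class p M f", OF Lp_class_self[OF assms]]
  by (auto simp: Lp_class_def)

lemma Lp_seminorm_cong_AE:
  assumes "f \<in> borel_measurable M" "g \<in> borel_measurable M" "AE x in M. f x = g x"
  shows "Lp_seminorm p M f = Lp_seminorm p M g"
proof -
  have "(\<integral>x. norm (f x) powr p \<partial>M) = (\<integral>x. norm (g x) powr p \<partial>M)"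
    using assms by (intro integral_cong_AE) auto
  then show ?thesis by (simp add: Lp_seminorm_def)
qed

lemma Lp_norm_class:
  assumes "f \<in> Lp_functions p M"
  shows "Lp_norm p M (Lp_class p M f) = Lp_seminorm p M f"
  unfolding Lp_norm_def
  using Lp_class_some[OF assms] assms by (intro Lp_seminorm_cong_AE) (auto dest: Lp_functionsD)

lemma Lp_dist_class:
  assumes "f \<in> Lp_functions p M" "g \<in> Lp_functions p M"
  shows "Lp_dist p M (Lp_class p M f) (Lp_class p M g) = Lp_seminorm p M (\<lambda>x. f x - g x)"
  unfolding Lp_dist_def
proof (rule Lp_seminorm_cong_AE)
  show "AE x in M. (SOME h. h \<in> Lp_class p M f) x - (SOME h. h \<in> Lp_class p M g) x = f x - g x"
    using Lp_class_some(2)[OF assms(1)] Lp_class_some(2)[OF assms(2)] by eventually_elim simp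
qed (use Lp_class_some[OF assms(1)] Lp_class_some[OF assms(2)] assms in
      \<open>auto dest!: Lp_functionsD(1) intro!: borel_measurable_diff\<close>)

lemma powr_add_le_weighted:
  fixes x y a b p :: real
  assumes p: "1 \<le> p" and "0 < a" "0 < b" "0 \<le> x" "0 \<le> y"
  shows "(x + y) powr p \<le> (a + b) powr p * (a / (a + b) * (x powr p / a powr p)
                                           + b / (a + b) * (y powr p / b powr p))"
proof -
  have zero: "v powr p \<le> (c + d) powr p * (d / (c + d) * (v powr p / d powr p))"
    if "0 < c" "0 < d" "0 \<le> v" for c d v :: real
  proof -
    have "d powr (p - 1) \<le> (c + d) powr (p - 1)"
      using that p by (intro powr_mono2) auto
    moreover have "d powr (p - 1) = d powr p / d" "(c + d) powr (p - 1) = (c + d) powr p / (c + d)"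
      using that by (simp_all add: powr_diff)
    ultimately have "d powr p / d * (d / d powr p) \<le> (c + d) powr p / (c + d) * (d / d powr p)"
      using that by (intro mult_right_mono) auto
    then have "1 \<le> (c + d) powr p / (c + d) * (d / d powr p)"
      using that by simp
    from mult_right_mono[OF this, of "v powr p"] show ?thesis by (simp add: field_simps)
  qed
  consider "x = 0" | "y = 0" | "0 < x" "0 < y" using assms by fastforce
  then show ?thesis
  proof cases
    case 1
    then show ?thesis using zero[of a b y] assms by simp
  next
    case 2
    then show ?thesis using zero[of b a x] assms by (simp add: add.commute)
  next
    case 3
    have "(a / (a + b) * (x / a) + b / (a + b) * (y / b)) powr p
        \<le> a / (a + b) * (x / a) powr p + b / (a + b) * (y / b) powr p"
      using convex_onD[OF powr_convex[OF p], of "b / (a + b)" "x / a" "y / b"] assms 3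
      by (simp add: field_simps)
    moreover have "a / (a + b) * (x / a) + b / (a + b) * (y / b) = (x + y) / (a + b)"
      using assms by (simp add: add_divide_distrib)
    ultimately have "(x + y) powr p / (a + b) powr p
        \<le> a / (a + b) * (x powr p / a powr p) + b / (a + b) * (y powr p / b powr p)"
      using assms by (simp add: powr_divide)
    then show ?thesis using assms by (simp add: pos_divide_le_eq mult.commute)
  qed
qed

lemma
  fixes f g :: "'b \<Rightarrow> 'a::{real_normed_field, euclidean_space}"
  assumes p: "1 \<le> p" and f: "f \<in> Lp_functions p M" and g: "g \<in> Lp_functions p M"
  shows Lp_functions_add: "(\<lambda>x. f x + g x) \<in> Lp_functions p M"
    and Lp_seminorm_triangle: "Lp_seminorm p M (\<lambda>x. f x + g x) \<le> Lp_seminorm p M f + Lp_seminorm p M g"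
proof -
  note [measurable] = Lp_functionsD(1)[OF f] Lp_functionsD(1)[OF g]
  note int = Lp_functionsD(2)[OF f] Lp_functionsD(2)[OF g]
  define I where "I h = (\<integral>x. norm (h x) powr p \<partial>M)" for h :: "'b \<Rightarrow> 'a"
  have I: "0 \<le> I h" "Lp_seminorm p M h = I h powr (1 / p)" for h
    by (auto simp: I_def Lp_seminorm_def)
  have bd: "norm (f x + g x) powr p
      \<le> (a + b) powr p * (a / (a + b) * (norm (f x) powr p / a powr p)
                          + b / (a + b) * (norm (g x) powr p / b powr p))"
    if "0 < a" "0 < b" for a b x
  proof -
    have "norm (f x + g x) powr p \<le> (norm (f x) + norm (g x)) powr p"
      using p by (intro powr_mono2 norm_triangle_ineq) auto
    with powr_add_le_weighted[OF p that, of "norm (f x)" "norm (g x)"] show ?thesis by simp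
  qed
  have intb: "integrable M (\<lambda>x. (a + b) powr p * (a / (a + b) * (norm (f x) powr p / a powr p)
                          + b / (a + b) * (norm (g x) powr p / b powr p)))" for a b
    using int by auto
  have ints: "integrable M (\<lambda>x. norm (f x + g x) powr p)"
    by (rule Bochner_Integration.integrable_bound[OF intb[of 1 1]])
       (use bd[of 1 1] in \<open>auto intro: order.trans[OF _ abs_ge_self]\<close>)
  then show "(\<lambda>x. f x + g x) \<in> Lp_functions p M" by (simp add: Lp_functions_def)
  have key: "Lp_seminorm p M (\<lambda>x. f x + g x) \<le> a + b"
    if "Lp_seminorm p M f < a" "Lp_seminorm p M g < b" for a b
  proof -
    have ab: "0 < a" "0 < b" using that by (auto simp: I intro: le_less_trans[OF powr_ge_zero])
    have le1: "I h \<le> c powr p" if "Lp_seminorm p M h < c" "0 < c" for h c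
    proof -
      have "(I h powr (1 / p)) powr p \<le> c powr p"
        using that p by (intro powr_mono2) (auto simp: I)
      then show ?thesis using p I(1)[of h] by (simp add: powr_powr)
    qed
    have "I (\<lambda>x. f x + g x) \<le> (\<integral>x. (a + b) powr p * (a / (a + b) * (norm (f x) powr p / a powr p)
                          + b / (a + b) * (norm (g x) powr p / b powr p)) \<partial>M)"
      unfolding I_def by (intro integral_mono ints intb bd ab)
    also have "\<dots> = (a + b) powr p * (a / (a + b) * (I f / a powr p) + b / (a + b) * (I g / b powr p))"
      using int by (simp add: I_def)
    also have "\<dots> \<le> (a + b) powr p * (a / (a + b) * 1 + b / (a + b) * 1)"
      using ab le1[OF that(1) ab(1)] le1[OF that(2) ab(2)]
      by (intro mult_left_mono add_mono) auto
    also have "\<dots> = (a + b) powr p"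
      using ab by (simp flip: add_divide_distrib)
    finally have "I (\<lambda>x. f x + g x) powr (1 / p) \<le> ((a + b) powr p) powr (1 / p)"
      using p I(1) by (intro powr_mono2) auto
    then show ?thesis using p ab by (simp add: I powr_powr)
  qed
  show "Lp_seminorm p M (\<lambda>x. f x + g x) \<le> Lp_seminorm p M f + Lp_seminorm p M g"
  proof (rule field_le_epsilon)
    fix e :: real assume "0 < e"
    then show "Lp_seminorm p M (\<lambda>x. f x + g x) \<le> Lp_seminorm p M f + Lp_seminorm p M g + e"
      using key[of "Lp_seminorm p M f + e / 2" "Lp_seminorm p M g + e / 2"] by simp
  qed
qed

lemma Lp_functions_diff:
  assumes "1 \<le> p" "f \<in> Lp_functions p M" "g \<in> Lp_functions p M"
  shows "(\<lambda>x. f x - g x) \<in> Lp_functions p M"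
proof -
  have "(\<lambda>x. - g x) \<in> Lp_functions p M" using assms(3) by (auto simp: Lp_functions_def)
  from Lp_functions_add[OF assms(1,2) this] show ?thesis by simp
qed

lemma Lp_seminorm_eq_0:
  assumes "1 \<le> p" "f \<in> Lp_functions p M"
  shows "Lp_seminorm p M f = 0 \<longleftrightarrow> (AE x in M. f x = 0)"
  using integral_nonneg_eq_0_iff_AE[OF Lp_functionsD(2)[OF assms(2)]]
  by (simp add: Lp_seminorm_def)

lemma Lp_class_eq_iff:
  assumes "f \<in> Lp_functions p M" "g \<in> Lp_functions p M"
  shows "Lp_class p M f = Lp_class p M g \<longleftrightarrow> (AE x in M. f x = g x)"
proof
  assume "Lp_class p M f = Lp_class p M g"
  then show "AE x in M. f x = g x" using Lp_class_self[OF assms(1)] by (auto simp: Lp_class_def)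
next
  assume eq: "AE x in M. f x = g x"
  have "(AE x in M. h x = f x) \<longleftrightarrow> (AE x in M. h x = g x)" for h
    using eq by (intro eventually_cong) (auto elim: eventually_mono)
  then show "Lp_class p M f = Lp_class p M g" by (simp add: Lp_class_def)
qed

theorem Metric_space_Lp:
  assumes p: "1 \<le> p"
  shows "Metric_space (Lp_space p M ::
           ('b \<Rightarrow> 'a::{real_normed_field, euclidean_space}) set set) (Lp_dist p M)"
proof
  fix F G :: "('b \<Rightarrow> 'a) set"
  show "0 \<le> Lp_dist p M F G" by (simp add: Lp_dist_def Lp_seminorm_def)
  show "Lp_dist p M F G = Lp_dist p M G F"
    by (simp add: Lp_dist_def Lp_seminorm_def norm_minus_commute)
  assume "F \<in> Lp_space p M" "G \<in> Lp_space p M"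
  then obtain f g where fg: "f \<in> Lp_functions p M" "g \<in> Lp_functions p M"
    and [simp]: "F = Lp_class p M f" "G = Lp_class p M g"
    by (auto simp: Lp_space_def)
  show "Lp_dist p M F G = 0 \<longleftrightarrow> F = G"
    using Lp_seminorm_eq_0[OF p Lp_functions_diff[OF p fg]] fg
    by (simp add: Lp_dist_class Lp_class_eq_iff)
  fix H :: "('b \<Rightarrow> 'a) set"
  assume "H \<in> Lp_space p M"
  then obtain h where h: "h \<in> Lp_functions p M" and [simp]: "H = Lp_class p M h"
    by (auto simp: Lp_space_def)
  show "Lp_dist p M F H \<le> Lp_dist p M F G + Lp_dist p M G H"
    using Lp_seminorm_triangle[OF p Lp_functions_diff[OF p fg] Lp_functions_diff[OF p fg(2) h]] fg h
    by (simp add: Lp_dist_class)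
qed

section \<open>Compact operators\<close>

text \<open>
  A linear map \<open>T\<close> from a subspace \<open>X\<close> of \<open>L\<^sup>p(M)\<close> to \<open>L\<^sup>q(N)\<close> is compact if it maps the closed
  unit ball of \<open>X\<close> to a relatively compact set. That \<open>T\<close> takes values in \<open>L\<^sup>q(N)\<close> has to be
  required explicitly, as \<^const>\<open>closure_of\<close> ignores points outside the space.
\<close>

definition compact_Lp_operator ::
    "('b \<Rightarrow> 'a::{real_normed_field, euclidean_space}) set set \<Rightarrow> real \<Rightarrow> 'b measure \<Rightarrow>
     real \<Rightarrow> 'c measure \<Rightarrow> (('b \<Rightarrow> 'a) set \<Rightarrow> ('c \<Rightarrow> 'a) set) \<Rightarrow> bool" where
  "compact_Lp_operator X p M q N T \<longleftrightarrow>
     T ` X \<subseteq> Lp_space q N \<and>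
     compactin (Lp_topology q N) (Lp_topology q N closure_of (T ` {F \<in> X. Lp_norm p M F \<le> 1}))"

section \<open>Muntz spaces\<close>

definition lacunary :: "(nat \<Rightarrow> real) \<Rightarrow> bool" where
  "lacunary \<Lambda> \<longleftrightarrow> (\<forall>n. 0 < \<Lambda> n) \<and> (\<exists>r>1. \<forall>n. r * \<Lambda> n \<le> \<Lambda> (Suc n))"

definition muntz_polynomials ::
    "(nat \<Rightarrow> real) \<Rightarrow> (real \<Rightarrow> 'a::{real_normed_field, euclidean_space}) set" where
  "muntz_polynomials \<Lambda> = {\<lambda>t. \<Sum>n\<in>N. a n * of_real (t powr \<Lambda> n) | a N. finite N}"

text \<open>The closed linear span of the monomials in \<open>L\<^sup>q([0,1])\<close>.\<close>

definition muntz_space ::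
    "(nat \<Rightarrow> real) \<Rightarrow> real \<Rightarrow> (real \<Rightarrow> 'a::{real_normed_field, euclidean_space}) set set" where
  "muntz_space \<Lambda> q =
     Lp_topology q (lebesgue_on {0..1}) closure_of
       (Lp_class q (lebesgue_on {0..1}) ` muntz_polynomials \<Lambda>)"

text \<open>
  By the Clarkson--Erdos theorem every element of a lacunary Muntz space has exactly one
  representative of the form \<open>\<Sum>n. a n * x powr \<Lambda> n\<close>, with the series convergent for all \<open>x\<close> in
  \<open>[0,1)\<close>; \<open>muntz_coeffs\<close> is its sequence of coefficients. The value at \<open>x = 1\<close>, where the series
  may diverge, is irrelevant in \<open>L\<^sup>q([0,1])\<close>.
\<close>

definition muntz_coeffs ::
    "(nat \<Rightarrow> real) \<Rightarrow> (real \<Rightarrow> 'a::{real_normed_field, euclidean_space}) set \<Rightarrow> nat \<Rightarrow> 'a" where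
  "muntz_coeffs \<Lambda> F =
     (THE a. (\<forall>x\<in>{0..<1}. summable (\<lambda>n. a n * of_real (x powr \<Lambda> n))) \<and>
             (\<lambda>x. \<Sum>n. a n * of_real (x powr \<Lambda> n)) \<in> F)"

definition muntz_value ::
    "(nat \<Rightarrow> real) \<Rightarrow> (real \<Rightarrow> 'a::{real_normed_field, euclidean_space}) set \<Rightarrow> real \<Rightarrow> 'a" where
  "muntz_value \<Lambda> F x = (\<Sum>n. muntz_coeffs \<Lambda> F n * of_real (x powr \<Lambda> n))"

definition muntz_embedding ::
    "(nat \<Rightarrow> real) \<Rightarrow> real \<Rightarrow> real measure \<Rightarrow>
     (real \<Rightarrow> 'a::{real_normed_field, euclidean_space}) set \<Rightarrow> (real \<Rightarrow> 'a) set" where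
  "muntz_embedding \<Lambda> q \<mu> F = Lp_class q \<mu> (muntz_value \<Lambda> F)"

definition condition_b :: "(nat \<Rightarrow> real) \<Rightarrow> real measure \<Rightarrow> real \<Rightarrow> bool" where
  "condition_b \<Lambda> \<mu> p \<longleftrightarrow> (\<lambda>n. \<Lambda> n * (\<integral>t. t powr (p * \<Lambda> n) \<partial>\<mu>)) \<longlonglongrightarrow> 0"

end

theory Submission
  imports Defs "HOL-Probability.Distributions" "HOL-Real_Asymp.Real_Asymp"
begin

text \<open>
  Two estimates for \<open>f = \<Sum>n. a n * t powr \<Lambda> n\<close> reduce the theorem to diagonal operators on a
  weighted \<open>\<ell>\<^sup>q\<close>.

  Lower bound (Gurariy--Macaev): \<open>\<Sum>n. \<bar>a n\<bar>\<^sup>q / \<Lambda> n\<close> is at most a constant times the \<open>q\<close>-th power of the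
  norm of \<open>f\<close> in \<open>L\<^sup>q([0,1])\<close>. After \<open>t = exp (- u)\<close>, testing \<open>f\<close> against a suitable combination of
  Erlang densities of rate \<open>l n\<close> yields functionals with matrix \<open>(4 l n l m / (l n + l m)\<^sup>2) ^ K\<close>; for
  lacunary exponents and large \<open>K\<close> this is a small perturbation of the identity on \<open>\<ell>\<^sup>q\<close>.

  Upper bound: the \<open>q\<close>-th power of the norm of \<open>f\<close> in \<open>L\<^sup>q(\<mu>)\<close> is at most a constant times
  \<open>\<Sum>n. e n * \<bar>a n\<bar>\<^sup>q / \<Lambda> n\<close>, where \<open>e n\<close> is the supremum over \<open>m \<ge> n\<close> of \<open>\<Lambda> m * (\<integral>t. t powr (p * \<Lambda> m) \<partial>\<mu>)\<close>.
  Since \<open>e\<close> tends to 0, coordinatewise convergence of coefficients in a ball of the weighted \<open>\<ell>\<^sup>q\<close>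
  implies convergence in \<open>L\<^sup>q(\<mu>)\<close>.
\<close>

text \<open>The matrix of functionals comes from a Laplace transform: an Erlang density of rate l,
  integrated against exp (- t u), gives z ^ (k + 1) with z = l / (l + t). The polynomial 4 z (1 - z)
  equals 1 exactly at t = l, and its K-th power is a combination of such transforms. Since the ratio
  r may be close to 1, a single power can leave too much weight off the diagonal; this forces the
  choice of K from r. Summing the functionals over n costs only a constant, because the densities
  divided by their rates have a bounded sum at every u.

  In the upper bound an index n is coupled only with integrals belonging to m \<ge> n, which is why
  a tail supremum is the right weight. Compactness is shown for the image of a whole coefficient
  ball rather than of the unit ball of the Muntz space: the coefficient ball is stable under
  coordinatewise limits, while a limit of coefficient sequences need not visibly belong to an
  element of the unit ball.\<close>

section \<open>Elementary inequalities for real powers\<close>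

text \<open>Every \<open>x i\<close> is bounded by the l^q norm of x. This is cruder than Hoelder's
  inequality, but it needs no conjugate exponent, and in each use the weights w have a controlled
  sum.\<close>

lemma sum_mult_powr_le:
  fixes w x :: "'i \<Rightarrow> real"
  assumes "finite A" "0 < q" "\<And>i. i \<in> A \<Longrightarrow> 0 \<le> w i" "\<And>i. i \<in> A \<Longrightarrow> 0 \<le> x i"
  shows "(\<Sum>i\<in>A. w i * x i) powr q \<le> (\<Sum>i\<in>A. w i) powr q * (\<Sum>i\<in>A. x i powr q)"
proof -
  define S where "S = (\<Sum>i\<in>A. x i powr q)"
  have S: "0 \<le> S" unfolding S_def by (intro sum_nonneg) auto
  have le: "x i \<le> S powr (1 / q)" if "i \<in> A" for i
  proof -
    have "x i powr q \<le> S"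
      unfolding S_def using that assms by (intro member_le_sum) auto
    then have "(x i powr q) powr (1 / q) \<le> S powr (1 / q)"
      using assms by (intro powr_mono2) auto
    then show ?thesis using assms that by (simp add: powr_powr)
  qed
  have "(\<Sum>i\<in>A. w i * x i) \<le> (\<Sum>i\<in>A. w i * S powr (1 / q))"
    using assms le by (intro sum_mono mult_left_mono) auto
  then have "(\<Sum>i\<in>A. w i * x i) powr q \<le> ((\<Sum>i\<in>A. w i) * S powr (1 / q)) powr q"
    using assms by (intro powr_mono2) (auto simp: sum_distrib_right intro!: sum_nonneg)
  also have "\<dots> = (\<Sum>i\<in>A. w i) powr q * S"
    using assms S by (simp add: powr_mult powr_powr sum_nonneg)
  finally show ?thesis unfolding S_def .
qed

lemma add_powr_le:
  fixes x y q :: real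
  assumes "0 < q" "0 \<le> x" "0 \<le> y"
  shows "(x + y) powr q \<le> 2 powr q * (x powr q + y powr q)"
  using sum_mult_powr_le[of UNIV q "\<lambda>_. 1" "\<lambda>b. if b then x else y"] assms
  by (simp add: UNIV_bool add.commute)

text \<open>The supporting line behind Jensen's inequality. Convexity gives it for positive c and x.
  At c = 0 the left side is 0, also for q = 1 because \<open>0 powr 0 = 0\<close>; at x = 0 it
  reduces to 1 \<le> q.\<close>

lemma powr_ge_tangent:
  fixes c x q :: real
  assumes "1 \<le> q" "0 \<le> c" "0 \<le> x"
  shows "c powr q + q * c powr (q - 1) * (x - c) \<le> x powr q"
proof -
  consider "c = 0" | "x = 0" "0 < c" | "0 < x" "0 < c" using assms by linarith
  then show ?thesis
  proof cases
    case 2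
    then have "c powr (q - 1) * c = c powr q" by (simp add: powr_diff)
    moreover have "1 * c powr q \<le> q * c powr q" using assms by (intro mult_right_mono) auto
    ultimately show ?thesis using 2 by (simp add: mult.assoc)
  next
    case 3
    have "((\<lambda>x. x powr q) has_real_derivative q * c powr (q - 1)) (at c within {0<..})"
      using 3 by (intro has_real_derivative_powr has_field_derivative_at_within) auto
    from convex_on_imp_above_tangent[OF powr_convex[OF assms(1)] _ _ _ this, of x]
    show ?thesis using 3 by (auto simp: interior_open)
  qed (use assms in auto)
qed

text \<open>Jensen's inequality for the probability density k: integrate the tangent line at the
  mean c of \<open>norm (f x)\<close>, where the linear term has integral 0.\<close>

lemma norm_integral_powr_le:
  fixes f :: "'b \<Rightarrow> 'a::{banach, second_countable_topology}"
  assumes q: "1 \<le> q" and k: "\<And>x. 0 \<le> k x" "integrable M k" "(\<integral>x. k x \<partial>M) = 1"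
    and f: "integrable M (\<lambda>x. k x *\<^sub>R f x)" and fq: "integrable M (\<lambda>x. k x * norm (f x) powr q)"
  shows "norm (\<integral>x. k x *\<^sub>R f x \<partial>M) powr q \<le> (\<integral>x. k x * norm (f x) powr q \<partial>M)"
proof -
  define c where "c = (\<integral>x. k x * norm (f x) \<partial>M)"
  have n: "integrable M (\<lambda>x. k x * norm (f x))" using integrable_norm[OF f] k by simp
  have c: "0 \<le> c" unfolding c_def using k by (intro integral_nonneg_AE) auto
  have "norm (\<integral>x. k x *\<^sub>R f x \<partial>M) \<le> c"
    unfolding c_def using integral_norm_bound[of M "\<lambda>x. k x *\<^sub>R f x"] k by simp
  then have "norm (\<integral>x. k x *\<^sub>R f x \<partial>M) powr q \<le> c powr q"
    using q by (intro powr_mono2) auto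
  also have "\<dots> = (\<integral>x. c powr q * k x + q * c powr (q - 1) * (k x * norm (f x) - c * k x) \<partial>M)"
    using n k by (simp add: c_def)
  also have "\<dots> \<le> (\<integral>x. k x * norm (f x) powr q \<partial>M)"
  proof (rule integral_mono[OF _ fq])
    show "c powr q * k x + q * c powr (q - 1) * (k x * norm (f x) - c * k x) \<le> k x * norm (f x) powr q"
      for x using mult_left_mono[OF powr_ge_tangent[OF q c norm_ge_zero, of "f x"] k(1)[of x]]
      by (simp add: algebra_simps)
  qed (use n k in auto)
  finally show ?thesis .
qed

section \<open>Sums along lacunary sequences\<close>

lemma geometric_le:
  fixes l :: "nat \<Rightarrow> real"
  assumes "0 \<le> r" "\<And>n. r * l n \<le> l (Suc n)" "m \<le> n"
  shows "r ^ (n - m) * l m \<le> l n"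
proof -
  have "r ^ j * l m \<le> l (m + j)" for j
  proof (induction j)
    case (Suc j)
    have "r ^ Suc j * l m \<le> r * l (m + j)"
      using mult_left_mono[OF Suc assms(1)] by (simp add: mult.assoc)
    also have "\<dots> \<le> l (m + Suc j)" using assms(2)[of "m + j"] by simp
    finally show ?case .
  qed simp
  from this[of "n - m"] assms(3) show ?thesis by simp
qed

lemma sum_power_inj_le:
  fixes \<gamma> :: real
  assumes "0 \<le> \<gamma>" "\<gamma> < 1" "finite A" "inj_on d A"
  shows "(\<Sum>m\<in>A. \<gamma> ^ d m) \<le> 1 / (1 - \<gamma>)"
proof -
  have "(\<Sum>m\<in>A. \<gamma> ^ d m) = (\<Sum>j\<in>d ` A. \<gamma> ^ j)"
    using assms by (simp add: sum.reindex)
  also have "\<dots> \<le> (\<Sum>j. \<gamma> ^ j)"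
    using assms by (intro sum_le_suminf) (auto intro: summable_geometric)
  also have "\<dots> = 1 / (1 - \<gamma>)" using assms by (intro suminf_geometric) auto
  finally show ?thesis .
qed

text \<open>Going away from n, the terms decay at least like powers of \<open>r powr - s\<close>, so
  each sum is comparable with its extreme possible term.\<close>

lemma
  fixes l :: "nat \<Rightarrow> real" and r s :: real
  assumes r: "1 < r" and l: "\<And>n. 0 < l n" "\<And>n. r * l n \<le> l (Suc n)" and s: "0 < s" and A: "finite A"
  shows sum_lacunary_le: "(\<And>m. m \<in> A \<Longrightarrow> m \<le> n) \<Longrightarrow>
           (\<Sum>m\<in>A. l m powr s) \<le> 1 / (1 - r powr - s) * l n powr s"
    and sum_lacunary_inverse_le: "(\<And>m. m \<in> A \<Longrightarrow> n \<le> m) \<Longrightarrow>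
           (\<Sum>m\<in>A. l m powr - s) \<le> 1 / (1 - r powr - s) * l n powr - s"
proof -
  define \<gamma> where "\<gamma> = r powr - s"
  have \<gamma>: "0 \<le> \<gamma>" "\<gamma> < 1" using r s by (auto simp: \<gamma>_def powr_minus_divide)
  have key: "l m powr s \<le> \<gamma> ^ (k - m) * l k powr s" if "m \<le> k" for m k
  proof -
    have "(r ^ (k - m) * l m) powr s \<le> l k powr s"
      using geometric_le[of r l m k] r l s that by (intro powr_mono2) (auto intro: less_imp_le)
    moreover have "(r ^ (k - m) * l m) powr s = (r powr s) ^ (k - m) * l m powr s"
      using r l s by (simp add: powr_mult powr_powr flip: powr_realpow) (simp add: mult.commute)
    ultimately have "\<gamma> ^ (k - m) * ((r powr s) ^ (k - m) * l m powr s) \<le> \<gamma> ^ (k - m) * l k powr s"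
      using \<gamma> by (intro mult_left_mono) auto
    moreover have "\<gamma> ^ (k - m) * ((r powr s) ^ (k - m)) = 1"
      using r by (simp add: \<gamma>_def flip: power_mult_distrib powr_add)
    ultimately show ?thesis by (simp add: mult.assoc[symmetric])
  qed
  show "(\<Sum>m\<in>A. l m powr s) \<le> 1 / (1 - r powr - s) * l n powr s" if "\<And>m. m \<in> A \<Longrightarrow> m \<le> n"
  proof -
    have "(\<Sum>m\<in>A. l m powr s) \<le> (\<Sum>m\<in>A. \<gamma> ^ (n - m) * l n powr s)"
      using key that by (intro sum_mono) auto
    also have "\<dots> = (\<Sum>m\<in>A. \<gamma> ^ (n - m)) * l n powr s" by (simp add: sum_distrib_right)
    also have "\<dots> \<le> 1 / (1 - \<gamma>) * l n powr s"
      using that by (intro mult_right_mono sum_power_inj_le \<gamma> A inj_onI) (metis diff_diff_cancel, simp)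
    finally show ?thesis by (simp add: \<gamma>_def)
  qed
  show "(\<Sum>m\<in>A. l m powr - s) \<le> 1 / (1 - r powr - s) * l n powr - s" if "\<And>m. m \<in> A \<Longrightarrow> n \<le> m"
  proof -
    have "l m powr - s \<le> \<gamma> ^ (m - n) * l n powr - s" if "m \<in> A" for m
    proof -
      have "l n powr s \<le> \<gamma> ^ (m - n) * l m powr s" using key \<open>\<And>m. m \<in> A \<Longrightarrow> n \<le> m\<close> that by auto
      then have "(l m powr - s * l n powr - s) * l n powr s \<le> (l m powr - s * l n powr - s) * (\<gamma> ^ (m - n) * l m powr s)"
        by (intro mult_left_mono) auto
      then show ?thesis using l(1)[of n] l(1)[of m] by (simp add: powr_minus field_simps)
    qed
    then have "(\<Sum>m\<in>A. l m powr - s) \<le> (\<Sum>m\<in>A. \<gamma> ^ (m - n) * l n powr - s)"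
      by (intro sum_mono) auto
    also have "\<dots> = (\<Sum>m\<in>A. \<gamma> ^ (m - n)) * l n powr - s" by (simp add: sum_distrib_right)
    also have "\<dots> \<le> 1 / (1 - \<gamma>) * l n powr - s"
      using that by (intro mult_right_mono sum_power_inj_le \<gamma> A inj_onI) (metis eq_diff_iff, simp)
    finally show ?thesis by (simp add: \<gamma>_def)
  qed
qed

text \<open>Split at \<open>l m * u = 1\<close>. On each side the sum is lacunary and dominated by
  its term nearest to the threshold, which is at most 1; hence the bound is independent of u and
  A.\<close>

lemma sum_min_lacunary_le:
  fixes l :: "nat \<Rightarrow> real"
  assumes r: "1 < r" and l: "\<And>n. 0 < l n" "\<And>n. r * l n \<le> l (Suc n)" and A: "finite A" and u: "0 < u"
  shows "(\<Sum>m\<in>A. min (l m * u) (1 / (l m * u))) \<le> 2 / (1 - 1 / r)"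
proof -
  define B where "B = {m \<in> A. l m * u \<le> 1}"
  define D where "D = {m \<in> A. 1 < l m * u}"
  have fin: "finite B" "finite D" using A by (auto simp: B_def D_def)
  have c: "0 < 1 / (1 - 1 / r)" "r powr - 1 = 1 / r" using r by (auto simp: powr_minus_divide)
  have 1: "(\<Sum>m\<in>B. l m * u) \<le> 1 / (1 - 1 / r)"
  proof (cases "B = {}")
    case False
    have "(\<Sum>m\<in>B. l m powr 1) \<le> 1 / (1 - r powr - 1) * l (Max B) powr 1"
      using fin by (intro sum_lacunary_le r l) auto
    then have "(\<Sum>m\<in>B. l m) * u \<le> 1 / (1 - 1 / r) * l (Max B) * u"
      using l u c by (intro mult_right_mono) (auto simp: abs_of_pos)
    also have "\<dots> = 1 / (1 - 1 / r) * (l (Max B) * u)" by simp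
    also have "\<dots> \<le> 1 / (1 - 1 / r) * 1"
      using Max_in[OF fin(1) False] c by (intro mult_left_mono) (auto simp: B_def)
    finally show ?thesis by (simp add: sum_distrib_right)
  qed (use c in simp)
  have 2: "(\<Sum>m\<in>D. 1 / (l m * u)) \<le> 1 / (1 - 1 / r)"
  proof (cases "D = {}")
    case False
    have "(\<Sum>m\<in>D. l m powr - 1) \<le> 1 / (1 - r powr - 1) * l (Min D) powr - 1"
      using fin by (intro sum_lacunary_inverse_le r l) auto
    then have "(\<Sum>m\<in>D. 1 / l m) * (1 / u) \<le> 1 / (1 - 1 / r) * (1 / l (Min D)) * (1 / u)"
      using l u c by (intro mult_right_mono) (auto simp: powr_minus_divide abs_of_pos)
    also have "\<dots> = 1 / (1 - 1 / r) * (1 / (l (Min D) * u))" by simp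
    also have "\<dots> \<le> 1 / (1 - 1 / r) * 1"
      using Min_in[OF fin(2) False] c by (intro mult_left_mono) (auto simp: D_def)
    finally show ?thesis by (simp add: sum_divide_distrib)
  qed (use c in simp)
  have "(\<Sum>m\<in>A. min (l m * u) (1 / (l m * u)))
      = (\<Sum>m\<in>B. min (l m * u) (1 / (l m * u))) + (\<Sum>m\<in>D. min (l m * u) (1 / (l m * u)))"
    using A by (subst sum.union_disjoint[symmetric]) (auto simp: B_def D_def intro!: sum.cong)
  also have "\<dots> \<le> (\<Sum>m\<in>B. l m * u) + (\<Sum>m\<in>D. 1 / (l m * u))"
    by (intro add_mono sum_mono) auto
  finally show ?thesis using 1 2 by simp
qed

section \<open>The lower bound for exponential sums\<close>

lemma
  assumes "0 < l"
  shows integrable_erlang_density: "integrable lborel (erlang_density k l)"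
    and integral_erlang_density: "(\<integral>u. erlang_density k l u \<partial>lborel) = 1"
proof -
  have "has_bochner_integral lborel (erlang_density k l) 1"
    using nn_integral_erlang_ith_moment[OF assms, of k 0] assms
    by (intro has_bochner_integral_nn_integral) auto
  then show "integrable lborel (erlang_density k l)" "(\<integral>u. erlang_density k l u \<partial>lborel) = 1"
    by (auto simp: has_bochner_integral_iff)
qed

text \<open>Exponential tilting stays inside the Erlang family. Integrating both sides gives the
  Laplace transform \<open>(l / (l + t)) ^ Suc k\<close>.\<close>

lemma erlang_density_mult_exp:
  assumes "0 < l" "0 < t"
  shows "erlang_density k l u * exp (- t * u) = (l / (l + t)) ^ Suc k * erlang_density k (l + t) u"
proof -
  have "exp ((- l - t) * u) = exp (- (l * u)) * exp (- (t * u))"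
    by (simp add: exp_add[symmetric] algebra_simps)
  then show ?thesis
    using assms by (simp add: erlang_density_def power_divide del: power_Suc)
qed

text \<open>With \<open>v = l * u\<close> the left side is
  \<open>v ^ k * exp (- v) / fact k\<close>. The inequality
  \<open>v ^ n * exp (- v) \<le> fact n\<close>, one term of the exponential series, gives the
  factor v with n = k - 1 and the factor 1 / v with n = k + 1.\<close>

lemma erlang_density_le:
  assumes l: "0 < l" and k: "1 \<le> k" and u: "0 < u"
  shows "erlang_density k l u / l \<le> real (k + 1) * min (l * u) (1 / (l * u))"
proof -
  define v where "v = l * u"
  have v: "0 < v" using l u by (simp add: v_def)
  have le: "v ^ n * exp (- v) \<le> fact n" for n
  proof -
    have "v ^ n / fact n \<le> exp v"
      using sum_le_suminf[OF summable_exp_generic[of v], of "{n}"] v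
      by (simp add: exp_def divide_inverse mult.commute)
    then have "v ^ n / fact n * exp (- v) \<le> exp v * exp (- v)" by (intro mult_right_mono) auto
    then show ?thesis by (simp add: exp_minus field_simps)
  qed
  have eq: "erlang_density k l u / l = v ^ k * exp (- v) / fact k"
    using l u by (simp add: erlang_density_def v_def power_mult_distrib)
  have "v ^ k * exp (- v) = v * (v ^ (k - 1) * exp (- v))"
    using k by (cases k) auto
  also have "\<dots> \<le> v * fact (k - 1)" using v le by (intro mult_left_mono) auto
  also have "\<dots> \<le> v * fact k" using v by (intro mult_left_mono fact_mono) auto
  finally have "v ^ k * exp (- v) / fact k \<le> 1 * v" by (simp add: field_simps)
  also have "\<dots> \<le> real (k + 1) * v" using v by (intro mult_right_mono) auto
  finally have 1: "v ^ k * exp (- v) / fact k \<le> real (k + 1) * v" .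
  have "v * (v ^ k * exp (- v)) \<le> real (k + 1) * fact k" using le[of "k + 1"] by (simp add: algebra_simps)
  then have "v ^ k * exp (- v) / fact k \<le> real (k + 1) * (1 / v)" using v by (simp add: field_simps)
  with 1 show ?thesis unfolding eq v_def[symmetric] by (simp add: min_def)
qed

text \<open>Only rates comparable with 1 / u contribute substantially, and a lacunary sequence has
  few of them. At u = 0 the densities vanish because k \<ge> 1.\<close>

lemma sum_erlang_density_le:
  fixes l :: "nat \<Rightarrow> real"
  assumes r: "1 < r" and l: "\<And>n. 0 < l n" "\<And>n. r * l n \<le> l (Suc n)" and k: "1 \<le> k" and A: "finite A"
  shows "(\<Sum>n\<in>A. erlang_density k (l n) u / l n) \<le> real (k + 1) * (2 / (1 - 1 / r)) * indicator {0..} u"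
proof (cases "0 < u")
  case True
  have "(\<Sum>n\<in>A. erlang_density k (l n) u / l n) \<le> (\<Sum>n\<in>A. real (k + 1) * min (l n * u) (1 / (l n * u)))"
    using erlang_density_le[OF l(1) k True] by (intro sum_mono) auto
  also have "\<dots> = real (k + 1) * (\<Sum>n\<in>A. min (l n * u) (1 / (l n * u)))" by (simp add: sum_distrib_left)
  also have "\<dots> \<le> real (k + 1) * (2 / (1 - 1 / r))"
    by (intro mult_left_mono sum_min_lacunary_le r l A True) auto
  finally show ?thesis using True by simp
next
  case False
  then have "erlang_density k (l n) u = 0" for n using k by (auto simp: erlang_density_def)
  then show ?thesis using r by (auto simp: indicator_def)
qed

text \<open>Large powers of this kernel are concentrated near the diagonal, since it is submultiplicative
  in the ratio \<open>y / x \<ge> 1\<close>.\<close>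

definition mult_kernel :: "real \<Rightarrow> real \<Rightarrow> real" where
  "mult_kernel x y = 4 * x * y / (x + y)\<^sup>2"

lemma mult_kernel_commute: "mult_kernel x y = mult_kernel y x"
  by (simp add: mult_kernel_def ac_simps)

lemma mult_kernel_nonneg: "0 < x \<Longrightarrow> 0 < y \<Longrightarrow> 0 \<le> mult_kernel x y"
  by (simp add: mult_kernel_def)

lemma mult_kernel_self: "0 < x \<Longrightarrow> mult_kernel x x = 1"
  by (simp add: mult_kernel_def power2_eq_square)

lemma mult_kernel_le_1: "0 < x \<Longrightarrow> 0 < y \<Longrightarrow> mult_kernel x y \<le> 1"
  using sum_squares_bound[of x y]
  by (simp add: mult_kernel_def add_pos_pos divide_le_eq_1 power2_eq_square algebra_simps)

lemma mult_kernel_scale: "c \<noteq> 0 \<Longrightarrow> mult_kernel (c * x) (c * y) = mult_kernel x y"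
proof -
  assume c: "c \<noteq> 0"
  have "(c * x + c * y)\<^sup>2 = c\<^sup>2 * (x + y)\<^sup>2" by (simp add: power2_eq_square algebra_simps)
  then show ?thesis using c by (simp add: mult_kernel_def power2_eq_square)
qed

text \<open>After cancelling common factors this is the square of (1 + x) (1 + y) \<le> 2 (1 + x y),
  which rearranges to (x - 1) (y - 1) \<ge> 0.\<close>

lemma mult_kernel_mult_le:
  assumes "1 \<le> x" "1 \<le> y"
  shows "mult_kernel 1 (x * y) \<le> mult_kernel 1 x * mult_kernel 1 y"
proof -
  have "0 \<le> (x - 1) * (y - 1)" using assms by simp
  then have "(1 + x) * (1 + y) \<le> 2 * (1 + x * y)" by (simp add: algebra_simps)
  then have "((1 + x) * (1 + y))\<^sup>2 \<le> (2 * (1 + x * y))\<^sup>2" using assms by (intro power_mono) auto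
  then have "(1 + x)\<^sup>2 * (1 + y)\<^sup>2 \<le> 4 * (1 + x * y)\<^sup>2"
    unfolding power_mult_distrib by simp
  then have "4 * (x * y) * ((1 + x)\<^sup>2 * (1 + y)\<^sup>2) \<le> 4 * (x * y) * (4 * (1 + x * y)\<^sup>2)"
    using assms by (intro mult_left_mono) auto
  moreover have "0 < 1 + x * y" using assms by (simp add: add_pos_nonneg)
  ultimately show ?thesis
    using assms by (simp add: mult_kernel_def divide_simps)
qed

lemma mult_kernel_le_power:
  assumes R: "1 < R" and "0 < x" "R ^ j * x \<le> y"
  shows "mult_kernel x y \<le> mult_kernel 1 R ^ j"
proof -
  have pw: "mult_kernel 1 (R ^ j) \<le> mult_kernel 1 R ^ j"
  proof (induction j)
    case (Suc j)
    have "mult_kernel 1 (R ^ Suc j) \<le> mult_kernel 1 R * mult_kernel 1 (R ^ j)"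
      using mult_kernel_mult_le[of R "R ^ j"] R by simp
    also have "\<dots> \<le> mult_kernel 1 R * mult_kernel 1 R ^ j"
      using Suc R by (intro mult_left_mono mult_kernel_nonneg) auto
    finally show ?case by simp
  qed (simp add: mult_kernel_def)
  \<comment> \<open>The excess of the ratio y / x over \<open>R ^ j\<close>; submultiplicativity
    splits it off, and its own kernel value is at most 1.\<close>
  define z where "z = y / x / R ^ j"
  have z: "1 \<le> z" "y = x * (R ^ j * z)" using assms by (auto simp: z_def field_simps)
  have "mult_kernel x y = mult_kernel 1 (R ^ j * z)"
    using mult_kernel_scale[of x 1 "R ^ j * z"] assms z by simp
  also have "\<dots> \<le> mult_kernel 1 (R ^ j) * mult_kernel 1 z"
    using R z by (intro mult_kernel_mult_le) auto
  also have "\<dots> \<le> mult_kernel 1 (R ^ j) * 1"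
    using R z by (intro mult_left_mono mult_kernel_le_1 mult_kernel_nonneg) auto
  finally show ?thesis using pw by simp
qed

lemma mult_kernel_less_1:
  assumes "1 < R" shows "mult_kernel 1 R < 1"
proof -
  have "0 < (R - 1)\<^sup>2" using assms by simp
  then have "4 * R < (1 + R)\<^sup>2" by (simp add: power2_eq_square algebra_simps)
  then show ?thesis using assms by (simp add: mult_kernel_def)
qed

text \<open>The kernel decays like x / y for large y / x, so one factor of it absorbs any power s
  \<le> 1 of that ratio. Such a ratio appears when the weights 1 / \<open>l n\<close> are normalised
  away.\<close>

lemma mult_kernel_mult_powr_le:
  assumes "0 < x" "0 < y" "0 \<le> s" "s \<le> 1"
  shows "mult_kernel x y * (y / x) powr s \<le> 4"
proof (cases "y \<le> x")
  case True
  have "(y / x) powr s \<le> 1" using powr_mono2[of s "y / x" 1] assms True by simp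
  then have "mult_kernel x y * (y / x) powr s \<le> 1 * 1"
    using assms by (intro mult_mono mult_kernel_le_1) auto
  then show ?thesis by simp
next
  case False
  have "(y / x) powr s \<le> (y / x) powr 1" using False assms by (intro powr_mono) auto
  then have "mult_kernel x y * (y / x) powr s \<le> mult_kernel x y * (y / x)"
    using assms by (intro mult_left_mono mult_kernel_nonneg) auto
  also have "\<dots> = 4 * (y\<^sup>2 / (x + y)\<^sup>2)" using assms by (simp add: mult_kernel_def power2_eq_square)
  also have "\<dots> \<le> 4 * 1" using assms by (intro mult_left_mono) (auto intro!: divide_le_eq_1[THEN iffD2] power_mono)
  finally show ?thesis by simp
qed

section \<open>Testing exponential sums against Erlang densities\<close>

lemma erlang_exp_sum:
  fixes a :: "nat \<Rightarrow> 'a::{banach, second_countable_topology}" and l :: "nat \<Rightarrow> real" and M :: nat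
  assumes l: "\<And>n. 0 < l n" and t: "0 < t"
  defines "F \<equiv> \<lambda>u. \<Sum>m<M. exp (- l m * u) *\<^sub>R a m"
  shows integrable_erlang_exp_sum: "integrable lborel (\<lambda>u. erlang_density k t u *\<^sub>R F u)"
    and integral_erlang_exp_sum: "(\<integral>u. erlang_density k t u *\<^sub>R F u \<partial>lborel) = (\<Sum>m<M. (t / (t + l m)) ^ Suc k *\<^sub>R a m)"
    and integrable_erlang_exp_sum_powr:
      "0 \<le> q \<Longrightarrow> integrable lborel (\<lambda>u. erlang_density k t u * norm (F u) powr q)"
proof -
  have eq: "erlang_density k t u *\<^sub>R F u = (\<Sum>m<M. ((t / (t + l m)) ^ Suc k * erlang_density k (t + l m) u) *\<^sub>R a m)" for u
    unfolding F_def scaleR_sum_right scaleR_scaleR erlang_density_mult_exp[OF t l] ..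
  have er: "integrable lborel (erlang_density k (t + l m))"
      "(\<integral>u. erlang_density k (t + l m) u \<partial>lborel) = 1" for m
    using t l[of m] by (auto intro!: integrable_erlang_density integral_erlang_density)
  show "integrable lborel (\<lambda>u. erlang_density k t u *\<^sub>R F u)"
    unfolding eq using er
    by (intro Bochner_Integration.integrable_sum integrable_scaleR_left integrable_mult_right) auto
  have "(\<integral>u. erlang_density k t u *\<^sub>R F u \<partial>lborel)
      = (\<Sum>m<M. \<integral>u. ((t / (t + l m)) ^ Suc k * erlang_density k (t + l m) u) *\<^sub>R a m \<partial>lborel)"
    unfolding eq using er
    by (intro Bochner_Integration.integral_sum integrable_scaleR_left integrable_mult_right) auto
  also have "\<dots> = (\<Sum>m<M. (t / (t + l m)) ^ Suc k *\<^sub>R a m)"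
    using er by (intro sum.cong refl, subst integral_scaleR_left) auto
  finally show "(\<integral>u. erlang_density k t u *\<^sub>R F u \<partial>lborel) = (\<Sum>m<M. (t / (t + l m)) ^ Suc k *\<^sub>R a m)" .
  assume q: "0 \<le> q"
  have F: "norm (F u) \<le> (\<Sum>m<M. norm (a m))" if "0 \<le> u" for u
  proof -
    have "norm (F u) \<le> (\<Sum>m<M. norm (exp (- l m * u) *\<^sub>R a m))" unfolding F_def by (rule norm_sum)
    also have "\<dots> \<le> (\<Sum>m<M. norm (a m))"
      using that l by (intro sum_mono) (auto intro!: mult_left_le_one_le simp: less_imp_le)
    finally show ?thesis .
  qed
  show "integrable lborel (\<lambda>u. erlang_density k t u * norm (F u) powr q)"
  proof (rule Bochner_Integration.integrable_bound)
    show "integrable lborel (\<lambda>u. erlang_density k t u * (\<Sum>m<M. norm (a m)) powr q)"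
      using integrable_erlang_density[OF t] by auto
    show "(\<lambda>u. erlang_density k t u * norm (F u) powr q) \<in> borel_measurable lborel"
      unfolding F_def by measurable
    show "AE u in lborel. norm (erlang_density k t u * norm (F u) powr q)
        \<le> norm (erlang_density k t u * (\<Sum>m<M. norm (a m)) powr q)"
    proof (intro AE_I2)
      fix u :: real
      show "norm (erlang_density k t u * norm (F u) powr q)
        \<le> norm (erlang_density k t u * (\<Sum>m<M. norm (a m)) powr q)"
      proof (cases "0 \<le> u")
        case True
        then show ?thesis using t q F[OF True]
          by (auto simp: abs_mult intro!: mult_left_mono powr_mono2)
      qed (auto simp: erlang_density_def)
    qed
  qed
qed

text \<open>Each functional is an average of F against a probability density, so Jensen moves the
  power q inside. After exchanging sum and integral, the densities over their rates add up to a
  bounded function.\<close>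

lemma exp_sum_erlang_functional_le:
  fixes a :: "nat \<Rightarrow> 'a::{banach, second_countable_topology}" and l :: "nat \<Rightarrow> real" and M :: nat
  assumes r: "1 < r" and l: "\<And>n. 0 < l n" "\<And>n. r * l n \<le> l (Suc n)" and q: "1 \<le> q" and k: "1 \<le> k"
  defines "F \<equiv> \<lambda>u. \<Sum>m<M. exp (- l m * u) *\<^sub>R a m"
  assumes I: "integrable lborel (\<lambda>u. indicator {0..} u * norm (F u) powr q)"
  shows "(\<Sum>n<M. norm (\<Sum>m<M. (l n / (l n + l m)) ^ Suc k *\<^sub>R a m) powr q / l n)
      \<le> real (k + 1) * (2 / (1 - 1 / r)) * (\<integral>u. indicator {0..} u * norm (F u) powr q \<partial>lborel)"
proof -
  have F: "(\<Sum>m<M. exp (- l m * u) *\<^sub>R a m) = F u" for u by (simp add: F_def)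
  note int = integrable_erlang_exp_sum[where l=l, OF l(1) l(1), where M=M and a=a, unfolded F]
    integral_erlang_exp_sum[where l=l, OF l(1) l(1), where M=M and a=a, unfolded F]
    integrable_erlang_exp_sum_powr[where l=l, OF l(1) l(1), where M=M and a=a and q=q, unfolded F]
  have int3: "integrable lborel (\<lambda>u. erlang_density k (l n) u / l n * norm (F u) powr q)" for n
    using int(3)[of k n] q by simp
  have "(\<Sum>n<M. norm (\<Sum>m<M. (l n / (l n + l m)) ^ Suc k *\<^sub>R a m) powr q / l n)
      \<le> (\<Sum>n<M. (\<integral>u. erlang_density k (l n) u / l n * norm (F u) powr q \<partial>lborel))"
  proof (intro sum_mono)
    fix n
    have "norm (\<integral>u. erlang_density k (l n) u *\<^sub>R F u \<partial>lborel) powr q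
        \<le> (\<integral>u. erlang_density k (l n) u * norm (F u) powr q \<partial>lborel)"
      using l q int by (intro norm_integral_powr_le integrable_erlang_density integral_erlang_density)
        (auto simp: less_imp_le)
    from divide_right_mono[OF this less_imp_le[OF l(1)[of n]]]
    show "norm (\<Sum>m<M. (l n / (l n + l m)) ^ Suc k *\<^sub>R a m) powr q / l n
        \<le> (\<integral>u. erlang_density k (l n) u / l n * norm (F u) powr q \<partial>lborel)"
      by (simp only: int(2)) simp
  qed
  also have "\<dots> = (\<integral>u. (\<Sum>n<M. erlang_density k (l n) u / l n) * norm (F u) powr q \<partial>lborel)"
    unfolding sum_distrib_right using int3 by (intro Bochner_Integration.integral_sum[symmetric])
  also have "\<dots> \<le> (\<integral>u. real (k + 1) * (2 / (1 - 1 / r)) * (indicator {0..} u * norm (F u) powr q) \<partial>lborel)"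
  proof (rule integral_mono)
    show "integrable lborel (\<lambda>u. (\<Sum>n<M. erlang_density k (l n) u / l n) * norm (F u) powr q)"
      unfolding sum_distrib_right using int3 by (intro Bochner_Integration.integrable_sum)
    show "(\<Sum>n<M. erlang_density k (l n) u / l n) * norm (F u) powr q
        \<le> real (k + 1) * (2 / (1 - 1 / r)) * (indicator {0..} u * norm (F u) powr q)" for u
      using mult_right_mono[OF sum_erlang_density_le[where l=l, OF r l k], of "{..<M}" "norm (F u) powr q" u]
      by (simp add: mult.assoc)
  qed (use I in auto)
  finally show ?thesis by simp
qed

text \<open>With z = x / (x + y) the kernel is 4 z (1 - z). Expanding \<open>(1 - z) ^ K\<close>
  leaves the powers \<open>z ^ (K + i)\<close>, which are Laplace transforms of Erlang densities
  with shape parameter K + i - 1.\<close>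

lemma sum_binomial_mult_kernel:
  assumes "0 < x" "0 < y"
  shows "(\<Sum>i\<le>K. 4 ^ K * (- 1) ^ i * real (K choose i) * (x / (x + y)) ^ (K + i)) = mult_kernel x y ^ K"
proof -
  define z where "z = x / (x + y)"
  have "(\<Sum>i\<le>K. 4 ^ K * (- 1) ^ i * real (K choose i) * z ^ (K + i))
      = (4 * z) ^ K * (\<Sum>i\<le>K. real (K choose i) * (- z) ^ i * 1 ^ (K - i))"
    unfolding sum_distrib_left
    by (intro sum.cong refl) (simp add: power_add power_mult_distrib power_minus[of z])
  also have "\<dots> = (4 * z * (1 - z)) ^ K"
    using binomial_ring[of "- z" 1 K] by (simp add: power_mult_distrib)
  also have "4 * z * (1 - z) = mult_kernel x y"
  proof -
    have "1 - z = y / (x + y)" using assms by (simp add: z_def field_simps)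
    then show ?thesis using assms by (simp add: z_def mult_kernel_def power2_eq_square)
  qed
  finally show ?thesis by (simp add: z_def)
qed

section \<open>Inverting a matrix close to the identity\<close>

text \<open>A Schur-type test. Half of the decay serves as summable weights along the rows, giving
  \<open>(1 / 2) powr q\<close>; the other half survives the exchange of sums and gives a further 1
  / 2 along the columns.\<close>

lemma sum_off_diagonal_le:
  fixes b :: "nat \<Rightarrow> real" and E :: "nat \<Rightarrow> nat \<Rightarrow> real"
  assumes q: "1 \<le> q" and b: "\<And>n. 0 \<le> b n"
    and E: "\<And>n m. m \<noteq> n \<Longrightarrow> 0 \<le> E n m" "\<And>n m. m \<noteq> n \<Longrightarrow> E n m \<le> (1 / 25) ^ ((n - m) + (m - n))"
  shows "(\<Sum>n<M. (\<Sum>m\<in>{..<M} - {n}. E n m * b m) powr q) \<le> (1 / 2) powr (q + 1) * (\<Sum>m<M. b m powr q)"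
proof -
  define d where "d n m = (n - m) + (m - n)" for n m :: nat
  \<comment> \<open>The square root of 1 / 25. Each side of the diagonal contributes at most
    \<kappa> / (1 - \<kappa>) = 1 / 4, so a row sums to at most 1 / 2.\<close>
  define \<kappa> :: real where "\<kappa> = 1 / 5"
  have row: "(\<Sum>m\<in>{..<M} - {n}. \<kappa> ^ d n m) \<le> 1 / 2" for n
  proof -
    have "(\<Sum>m\<in>{..<M} - {n}. \<kappa> ^ d n m) = (\<Sum>m\<in>{..<M} \<inter> {..<n}. \<kappa> ^ d n m) + (\<Sum>m\<in>{..<M} \<inter> {n<..}. \<kappa> ^ d n m)"
      by (subst sum.union_disjoint[symmetric]) (auto intro!: sum.cong)
    also have "(\<Sum>m\<in>{..<M} \<inter> {..<n}. \<kappa> ^ d n m) = \<kappa> * (\<Sum>m\<in>{..<M} \<inter> {..<n}. \<kappa> ^ (n - m - 1))"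
      unfolding sum_distrib_left by (intro sum.cong refl) (auto simp: d_def Suc_diff_Suc simp flip: power_Suc)
    also have "\<dots> \<le> \<kappa> * (1 / (1 - \<kappa>))"
      by (intro mult_left_mono sum_power_inj_le inj_onI) (auto simp: \<kappa>_def)
    also have "(\<Sum>m\<in>{..<M} \<inter> {n<..}. \<kappa> ^ d n m) = \<kappa> * (\<Sum>m\<in>{..<M} \<inter> {n<..}. \<kappa> ^ (m - n - 1))"
      unfolding sum_distrib_left by (intro sum.cong refl) (auto simp: d_def Suc_diff_Suc simp flip: power_Suc)
    also have "\<dots> \<le> \<kappa> * (1 / (1 - \<kappa>))"
      by (intro mult_left_mono sum_power_inj_le inj_onI) (auto simp: \<kappa>_def)
    finally show ?thesis by (simp add: \<kappa>_def)
  qed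
  have "(\<Sum>m\<in>{..<M} - {n}. E n m * b m) powr q \<le> (1 / 2) powr q * (\<Sum>m\<in>{..<M} - {n}. \<kappa> ^ d n m * b m powr q)" for n
  proof -
    have "(\<Sum>m\<in>{..<M} - {n}. E n m * b m) \<le> (\<Sum>m\<in>{..<M} - {n}. \<kappa> ^ d n m * (\<kappa> ^ d n m * b m))"
    proof (intro sum_mono)
      fix m assume "m \<in> {..<M} - {n}"
      then have "E n m * b m \<le> (1 / 25) ^ d n m * b m"
        using E(2)[of m n] b by (intro mult_right_mono) (auto simp: d_def)
      also have "(1 / 25) ^ d n m = \<kappa> ^ d n m * \<kappa> ^ d n m"
        by (simp add: \<kappa>_def flip: power_mult_distrib)
      finally show "E n m * b m \<le> \<kappa> ^ d n m * (\<kappa> ^ d n m * b m)" by (simp add: mult.assoc)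
    qed
    then have "(\<Sum>m\<in>{..<M} - {n}. E n m * b m) powr q
        \<le> (\<Sum>m\<in>{..<M} - {n}. \<kappa> ^ d n m * (\<kappa> ^ d n m * b m)) powr q"
      using q E(1) b by (intro powr_mono2 sum_nonneg mult_nonneg_nonneg) auto
    also have "\<dots> \<le> (\<Sum>m\<in>{..<M} - {n}. \<kappa> ^ d n m) powr q * (\<Sum>m\<in>{..<M} - {n}. (\<kappa> ^ d n m * b m) powr q)"
      using q b by (intro sum_mult_powr_le) (auto simp: \<kappa>_def)
    also have "\<dots> \<le> (1 / 2) powr q * (\<Sum>m\<in>{..<M} - {n}. \<kappa> ^ d n m * b m powr q)"
    proof (intro mult_mono sum_mono powr_mono2 row)
      fix m
      \<comment> \<open>A base at most 1 does not grow when raised to a power q \<ge> 1; this keeps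
        the column sums independent of q.\<close>
      have "(\<kappa> ^ d n m) powr q \<le> \<kappa> ^ d n m"
        using powr_mono'[of 1 q "\<kappa> ^ d n m"] q by (auto simp: \<kappa>_def power_le_one)
      then show "(\<kappa> ^ d n m * b m) powr q \<le> \<kappa> ^ d n m * b m powr q"
        using b by (auto simp: powr_mult \<kappa>_def intro!: mult_right_mono)
    qed (use q b in \<open>auto simp: \<kappa>_def intro!: sum_nonneg\<close>)
    finally show ?thesis .
  qed
  then have "(\<Sum>n<M. (\<Sum>m\<in>{..<M} - {n}. E n m * b m) powr q)
      \<le> (\<Sum>n<M. (1 / 2) powr q * (\<Sum>m\<in>{..<M} - {n}. \<kappa> ^ d n m * b m powr q))"
    by (intro sum_mono)
  also have "\<dots> = (1 / 2) powr q * (\<Sum>n<M. \<Sum>m | m < M \<and> m \<noteq> n. \<kappa> ^ d n m * b m powr q)"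
    unfolding sum_distrib_left by (intro sum.cong) auto
  also have "(\<Sum>n<M. \<Sum>m | m < M \<and> m \<noteq> n. \<kappa> ^ d n m * b m powr q)
      = (\<Sum>m<M. \<Sum>n | n < M \<and> m \<noteq> n. \<kappa> ^ d n m * b m powr q)"
    using sum.swap_restrict[of "{..<M}" "{..<M}" "\<lambda>n m. \<kappa> ^ d n m * b m powr q" "\<lambda>n m. m \<noteq> n"] by simp
  also have "\<dots> = (\<Sum>m<M. (\<Sum>n\<in>{..<M} - {m}. \<kappa> ^ d m n) * b m powr q)"
    unfolding sum_distrib_right by (intro sum.cong) (auto simp: d_def add.commute)
  also have "\<dots> \<le> (\<Sum>m<M. 1 / 2 * b m powr q)"
    using row by (intro sum_mono mult_right_mono) auto
  finally show ?thesis by (simp add: powr_add sum_divide_distrib[symmetric])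
qed

text \<open>The combined functionals L recover the coefficients up to an off-diagonal error of at
  most half the sum to be estimated, and that finite sum can be absorbed. The constant is fixed
  before M and a, so it is uniform in both.\<close>

lemma exp_sum_lower_bound:
  fixes l :: "nat \<Rightarrow> real"
  assumes r: "1 < r" and l: "\<And>n. 0 < l n" "\<And>n. r * l n \<le> l (Suc n)" and q: "1 \<le> q"
  obtains C where "0 \<le> C"
    "\<And>M (a :: nat \<Rightarrow> 'a::{banach, second_countable_topology}).
       integrable lborel (\<lambda>u. indicator {0..} u * norm (\<Sum>m<M. exp (- l m * u) *\<^sub>R a m) powr q) \<Longrightarrow>
       (\<Sum>n<M. norm (a n) powr q / l n)
       \<le> C * (\<integral>u. indicator {0..} u * norm (\<Sum>m<M. exp (- l m * u) *\<^sub>R a m) powr q \<partial>lborel)"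
proof -
  define \<theta> where "\<theta> = mult_kernel 1 r"
  have \<theta>: "0 \<le> \<theta>" "\<theta> < 1" using r by (auto simp: \<theta>_def mult_kernel_nonneg mult_kernel_less_1)
  obtain N where N: "\<theta> ^ N < 1 / 100" using real_arch_pow_inv[of "1 / 100" \<theta>] \<theta> by auto
  \<comment> \<open>K - 1 \<ge> N yields the decay 1 / 25 even after losing a factor 4. K \<ge> 2
    makes every shape parameter K + i - 1 at least 1.\<close>
  define K where "K = N + 2"
  have K: "2 \<le> K" "4 * \<theta> ^ (K - 1) \<le> 1 / 25"
  proof -
    have "\<theta> ^ (N + 1) \<le> \<theta> ^ N" using \<theta> by (intro power_decreasing) auto
    then show "4 * \<theta> ^ (K - 1) \<le> 1 / 25" using N by (simp add: K_def)
  qed (simp add: K_def)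
  define c where "c i = 4 ^ K * (- 1) ^ i * real (K choose i)" for i :: nat
  \<comment> \<open>The first factor is the cost of combining the functionals with coefficients c;
    the second collects their individual bounds, where k + 1 = K + i.\<close>
  define D where "D = (\<Sum>i\<le>K. \<bar>c i\<bar>) powr q * (\<Sum>i\<le>K. real (K + i) * (2 / (1 - 1 / r)))"
  show thesis
  proof (rule that)
    show "0 \<le> 2 * 2 powr q * D" using r by (auto simp: D_def intro!: mult_nonneg_nonneg sum_nonneg)
    fix M and a :: "nat \<Rightarrow> 'a"
    define F where "F u = (\<Sum>m<M. exp (- l m * u) *\<^sub>R a m)" for u
    define J where "J = (\<integral>u. indicator {0..} u * norm (F u) powr q \<partial>lborel)"
    assume "integrable lborel (\<lambda>u. indicator {0..} u * norm (\<Sum>m<M. exp (- l m * u) *\<^sub>R a m) powr q)"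
    note I = this
    define T where "T i n = (\<Sum>m<M. (l n / (l n + l m)) ^ (K + i) *\<^sub>R a m)" for i n
    define L where "L n = (\<Sum>i\<le>K. c i *\<^sub>R T i n)" for n
    have L: "L n = (\<Sum>m<M. mult_kernel (l n) (l m) ^ K *\<^sub>R a m)" for n
    proof -
      have "L n = (\<Sum>i\<le>K. \<Sum>m<M. (c i * (l n / (l n + l m)) ^ (K + i)) *\<^sub>R a m)"
        unfolding L_def T_def by (simp add: scaleR_sum_right)
      also have "\<dots> = (\<Sum>m<M. (\<Sum>i\<le>K. c i * (l n / (l n + l m)) ^ (K + i)) *\<^sub>R a m)"
        by (subst sum.swap) (simp add: scaleR_sum_left)
      finally show ?thesis unfolding c_def using l by (simp only: sum_binomial_mult_kernel)
    qed
    have Lle: "(\<Sum>n<M. norm (L n) powr q / l n) \<le> D * J"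
    proof -
      have "norm (L n) powr q / l n \<le> (\<Sum>i\<le>K. \<bar>c i\<bar>) powr q * (\<Sum>i\<le>K. norm (T i n) powr q / l n)" for n
      proof -
        have "norm (L n) \<le> (\<Sum>i\<le>K. \<bar>c i\<bar> * norm (T i n))"
          unfolding L_def by (rule order.trans[OF norm_sum]) simp
        then have "norm (L n) powr q \<le> (\<Sum>i\<le>K. \<bar>c i\<bar> * norm (T i n)) powr q"
          using q by (intro powr_mono2) auto
        also have "\<dots> \<le> (\<Sum>i\<le>K. \<bar>c i\<bar>) powr q * (\<Sum>i\<le>K. norm (T i n) powr q)"
          using q by (intro sum_mult_powr_le) auto
        finally show ?thesis using l(1)[of n]
          by (simp add: sum_divide_distrib[symmetric] divide_right_mono)
      qed
      then have "(\<Sum>n<M. norm (L n) powr q / l n)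
          \<le> (\<Sum>n<M. (\<Sum>i\<le>K. \<bar>c i\<bar>) powr q * (\<Sum>i\<le>K. norm (T i n) powr q / l n))"
        by (intro sum_mono)
      also have "\<dots> = (\<Sum>i\<le>K. \<bar>c i\<bar>) powr q * (\<Sum>i\<le>K. \<Sum>n<M. norm (T i n) powr q / l n)"
        by (simp only: sum_distrib_left[symmetric]) (subst sum.swap, simp)
      also have "\<dots> \<le> (\<Sum>i\<le>K. \<bar>c i\<bar>) powr q * (\<Sum>i\<le>K. real (K + i) * (2 / (1 - 1 / r)) * J)"
      proof (intro mult_left_mono sum_mono)
        fix i
        have k: "Suc (K + i - 1) = K + i" "1 \<le> K + i - 1" "K + i - 1 + 1 = K + i" using K by auto
        show "(\<Sum>n<M. norm (T i n) powr q / l n) \<le> real (K + i) * (2 / (1 - 1 / r)) * J"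
          using exp_sum_erlang_functional_le[where l=l, OF r l q k(2) I] unfolding k
          by (simp only: T_def J_def F_def)
      qed auto
      finally show ?thesis by (simp add: D_def sum_distrib_right mult.assoc)
    qed
    \<comment> \<open>Normalising by the weights turns the weighted l^q sum into a plain one; the
      matrix entries acquire the ratio \<open>(l m / l n) powr (1 / q)\<close>.\<close>
    define b where "b n = norm (a n) * l n powr - (1 / q)" for n
    define E where "E n m = mult_kernel (l n) (l m) ^ K * (l m / l n) powr (1 / q)" for n m
    have bq: "b n powr q = norm (a n) powr q / l n" for n
      using q l(1)[of n] by (simp add: b_def powr_mult powr_powr powr_minus_divide powr_divide)
    have E: "0 \<le> E n m" "m \<noteq> n \<Longrightarrow> E n m \<le> (1 / 25) ^ ((n - m) + (m - n))" for n m
    proof -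
      have k0: "0 \<le> mult_kernel (l n) (l m)" using l by (simp add: mult_kernel_nonneg)
      then show "0 \<le> E n m" by (simp add: E_def)
      assume ne: "m \<noteq> n"
      define d where "d = (n - m) + (m - n)"
      have d: "1 \<le> d" using ne by (auto simp: d_def)
      have kd: "mult_kernel (l n) (l m) \<le> \<theta> ^ d"
      proof (cases "n < m")
        case True
        then have "r ^ d * l n \<le> l m" using geometric_le[of r l n m] l r by (simp add: d_def)
        then show ?thesis unfolding \<theta>_def by (intro mult_kernel_le_power r l)
      next
        case False
        then have "r ^ d * l m \<le> l n" using geometric_le[of r l m n] l r by (simp add: d_def)
        then show ?thesis unfolding \<theta>_def by (subst mult_kernel_commute) (intro mult_kernel_le_power r l)
      qed
      \<comment> \<open>One kernel factor is spent on the ratio of weights at the price of a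
        constant 4, which is at most \<open>4 ^ d\<close> since d \<ge> 1. The other K - 1 factors
        supply the decay.\<close>
      have "E n m = mult_kernel (l n) (l m) ^ (K - 1) * (mult_kernel (l n) (l m) * (l m / l n) powr (1 / q))"
        using K by (simp add: E_def power_eq_if[of _ K])
      also have "\<dots> \<le> (\<theta> ^ d) ^ (K - 1) * 4"
        using kd k0 l q by (intro mult_mono power_mono mult_kernel_mult_powr_le) auto
      also have "\<dots> \<le> (\<theta> ^ d) ^ (K - 1) * 4 ^ d"
        using d \<theta> by (intro mult_left_mono) (auto intro: self_le_power)
      also have "\<dots> = (4 * \<theta> ^ (K - 1)) ^ d"
        by (simp add: power_mult_distrib power_mult[symmetric] mult.commute)
      also have "\<dots> \<le> (1 / 25) ^ d" using K \<theta> by (intro power_mono) auto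
      finally show "E n m \<le> (1 / 25) ^ ((n - m) + (m - n))" by (simp add: d_def)
    qed
    have bn: "b n powr q \<le> 2 powr q * (norm (L n) powr q / l n + (\<Sum>m\<in>{..<M} - {n}. E n m * b m) powr q)"
      if "n < M" for n
    proof -
      have "L n = a n + (\<Sum>m\<in>{..<M} - {n}. mult_kernel (l n) (l m) ^ K *\<^sub>R a m)"
        unfolding L using that l(1)[of n] by (subst sum.remove[of _ n]) (auto simp: mult_kernel_self)
      then have "norm (a n) = norm (L n - (\<Sum>m\<in>{..<M} - {n}. mult_kernel (l n) (l m) ^ K *\<^sub>R a m))" by simp
      also have "\<dots> \<le> norm (L n) + (\<Sum>m\<in>{..<M} - {n}. norm (mult_kernel (l n) (l m) ^ K *\<^sub>R a m))"
        by (rule order.trans[OF norm_triangle_ineq4]) (intro add_left_mono norm_sum)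
      finally have "b n \<le> (norm (L n) + (\<Sum>m\<in>{..<M} - {n}. norm (mult_kernel (l n) (l m) ^ K *\<^sub>R a m))) * l n powr - (1 / q)"
        unfolding b_def by (intro mult_right_mono) auto
      also have "\<dots> = norm (L n) * l n powr - (1 / q) + (\<Sum>m\<in>{..<M} - {n}. E n m * b m)"
      proof -
        have "norm (mult_kernel (l n) (l m) ^ K *\<^sub>R a m) * l n powr - (1 / q) = E n m * b m" for m
          using l(1)[of m] l(1)[of n] mult_kernel_nonneg[of "l n" "l m"]
          by (simp add: E_def b_def powr_divide powr_minus_divide less_imp_le)
        then show ?thesis by (simp add: distrib_right sum_distrib_right)
      qed
      finally have "b n powr q \<le> (norm (L n) * l n powr - (1 / q) + (\<Sum>m\<in>{..<M} - {n}. E n m * b m)) powr q"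
        using q by (intro powr_mono2) (auto simp: b_def)
      also have "\<dots> \<le> 2 powr q * ((norm (L n) * l n powr - (1 / q)) powr q + (\<Sum>m\<in>{..<M} - {n}. E n m * b m) powr q)"
        using q E by (intro add_powr_le) (auto simp: b_def intro!: sum_nonneg)
      also have "(norm (L n) * l n powr - (1 / q)) powr q = norm (L n) powr q / l n"
        using q l(1)[of n] by (simp add: powr_mult powr_powr powr_minus_divide powr_divide)
      finally show ?thesis .
    qed
    define S where "S = (\<Sum>n<M. b n powr q)"
    have "S \<le> (\<Sum>n<M. 2 powr q * (norm (L n) powr q / l n + (\<Sum>m\<in>{..<M} - {n}. E n m * b m) powr q))"
      unfolding S_def using bn by (intro sum_mono) auto
    also have "\<dots> = 2 powr q * ((\<Sum>n<M. norm (L n) powr q / l n) + (\<Sum>n<M. (\<Sum>m\<in>{..<M} - {n}. E n m * b m) powr q))"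
      by (simp only: sum_distrib_left[symmetric] sum.distrib)
    also have "\<dots> \<le> 2 powr q * (D * J + (1 / 2) powr (q + 1) * S)"
      unfolding S_def using Lle E by (intro mult_left_mono add_mono sum_off_diagonal_le q) (auto simp: b_def)
    also have "\<dots> = 2 powr q * D * J + 2 powr q * (1 / 2) powr (q + 1) * S" by (simp add: algebra_simps)
    \<comment> \<open>The off-diagonal bound exactly beats the loss \<open>2 powr q\<close> from
      separating the two summands, leaving S / 2 to be absorbed.\<close>
    also have "2 powr q * (1 / 2) powr (q + 1) = (1 / 2 :: real)"
      by (simp add: powr_add powr_divide)
    finally have "S \<le> 2 * 2 powr q * D * J" by simp
    then show "(\<Sum>n<M. norm (a n) powr q / l n)
       \<le> 2 * 2 powr q * D * (\<integral>u. indicator {0..} u * norm (\<Sum>m<M. exp (- l m * u) *\<^sub>R a m) powr q \<partial>lborel)"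
      by (simp add: S_def bq J_def F_def)
  qed
qed

section \<open>The lower bound for Muntz polynomials\<close>

text \<open>The map u to exp (- u) sends [0,\<infinity>) onto (0,1], which misses only the null set
  {0}. Borel measurability of h allows the result, obtained for the completed measure, to be read
  over \<open>lborel\<close>.\<close>

lemma
  fixes h :: "real \<Rightarrow> real"
  assumes [measurable]: "h \<in> borel_measurable borel" and h: "integrable (lebesgue_on {0..1}) h"
  shows integrable_substitution_exp:
      "integrable lborel (\<lambda>u. indicator {0..} u * (exp (- u) * h (exp (- u))))"
    and integral_substitution_exp:
      "(\<integral>u. indicator {0..} u * (exp (- u) * h (exp (- u))) \<partial>lborel) = (\<integral>t. h t \<partial>lebesgue_on {0..1})"
proof -
  have img: "(\<lambda>u. exp (- u)) ` {0..} = {0<..1::real}"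
  proof safe
    fix t :: real assume "t \<in> {0<..1}"
    then have "t = exp (- (- ln t))" "- ln t \<in> {0..}" by auto
    then show "t \<in> (\<lambda>u. exp (- u)) ` {0..}" by blast
  qed auto
  have h01: "set_integrable lebesgue {0..1} h"
      "(\<integral>t. h t \<partial>lebesgue_on {0..1}) = set_lebesgue_integral lebesgue {0..1} h"
    using h by (simp_all add: integrable_restrict_space integral_restrict_space set_integrable_def set_lebesgue_integral_def)
  have h1: "set_integrable lebesgue {0<..1} h"
    by (rule set_integrable_subset[OF h01(1)]) auto
  have eq: "set_lebesgue_integral lebesgue {0<..1} h = set_lebesgue_integral lebesgue {0..1} h"
    by (rule set_integral_discrete_difference[of "{0}"]) auto
  let ?k = "\<lambda>u. \<bar>- exp (- u)\<bar> * h (exp (- u))"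
  have "?k absolutely_integrable_on {0..} \<and> integral {0..} ?k = integral {0<..1} h"
  proof (subst has_absolute_integral_change_of_variables_1'[where g="\<lambda>u. exp (- u)" and f=h])
    show "((\<lambda>u. exp (- u)) has_real_derivative - exp (- x)) (at x within {0..})" for x :: real
      by (auto intro!: derivative_eq_intros)
    show "h absolutely_integrable_on (\<lambda>u. exp (- u)) ` {0..} \<and>
        integral ((\<lambda>u. exp (- u)) ` {0..}) h = integral {0<..1} h"
      unfolding img using h1 by simp
  qed (auto simp: inj_on_def)
  then have k: "set_integrable lebesgue {0..} ?k"
      "set_lebesgue_integral lebesgue {0..} ?k = set_lebesgue_integral lebesgue {0<..1} h"
    using h1 by (auto simp: set_lebesgue_integral_eq_integral(2))
  then show "integrable lborel (\<lambda>u. indicator {0..} u * (exp (- u) * h (exp (- u))))"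
    unfolding set_integrable_def by (subst (asm) integrable_completion) auto
  have "set_lebesgue_integral lebesgue {0..} ?k = (\<integral>u. indicator {0..} u * (exp (- u) * h (exp (- u))) \<partial>lborel)"
    unfolding set_lebesgue_integral_def by (subst integral_completion) auto
  with k eq h01 show "(\<integral>u. indicator {0..} u * (exp (- u) * h (exp (- u))) \<partial>lborel) = (\<integral>t. h t \<partial>lebesgue_on {0..1})"
    by simp
qed

lemma lacunaryE:
  assumes "lacunary \<Lambda>"
  obtains r where "1 < r" "\<And>n. 0 < \<Lambda> n" "\<And>n. r * \<Lambda> n \<le> \<Lambda> (Suc n)"
  using assms by (auto simp: lacunary_def)

lemma lacunary_mono:
  assumes "lacunary \<Lambda>" "m \<le> n"
  shows "\<Lambda> m \<le> \<Lambda> n"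
proof -
  obtain r where r: "1 < r" "\<And>n. 0 < \<Lambda> n" "\<And>n. r * \<Lambda> n \<le> \<Lambda> (Suc n)"
    using lacunaryE[OF assms(1)] by blast
  have "1 * \<Lambda> n \<le> r * \<Lambda> n" for n
    using r(1) r(2)[of n] by (intro mult_right_mono) auto
  then have "\<Lambda> n \<le> \<Lambda> (Suc n)" for n using r(3)[of n] by (metis mult_1 order.trans)
  then show ?thesis using assms(2) by (rule lift_Suc_mono_le)
qed

lemma integrable_muntz_polynomial_powr:
  fixes a :: "nat \<Rightarrow> 'a::{real_normed_field, euclidean_space}"
  assumes "\<And>n. 0 < \<Lambda> n" "0 \<le> q" "finite N"
  shows "integrable (lebesgue_on {0..1}) (\<lambda>t. norm (\<Sum>m\<in>N. a m * of_real (t powr \<Lambda> m)) powr q)"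
proof -
  interpret finite_measure "lebesgue_on {0..1::real}"
    by (rule finite_measure_lebesgue_on) auto
  show ?thesis
  proof (rule integrable_const_bound[where B="(\<Sum>m\<in>N. norm (a m)) powr q"])
    show "AE t in lebesgue_on {0..1}. norm (norm (\<Sum>m\<in>N. a m * of_real (t powr \<Lambda> m)) powr q) \<le> (\<Sum>m\<in>N. norm (a m)) powr q"
    proof (rule AE_I2)
      fix t :: real assume "t \<in> space (lebesgue_on {0..1})"
      then have t: "0 \<le> t" "t \<le> 1" by auto
      have "norm (\<Sum>m\<in>N. a m * of_real (t powr \<Lambda> m)) \<le> (\<Sum>m\<in>N. norm (a m * of_real (t powr \<Lambda> m)))"
        by (rule norm_sum)
      also have "\<dots> \<le> (\<Sum>m\<in>N. norm (a m))"
        using t assms(1) by (intro sum_mono) (auto simp: norm_mult powr_le1 less_imp_le intro!: mult_right_le_one_le)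
      finally show "norm (norm (\<Sum>m\<in>N. a m * of_real (t powr \<Lambda> m)) powr q) \<le> (\<Sum>m\<in>N. norm (a m)) powr q"
        using assms by (auto intro!: powr_mono2)
    qed
    show "(\<lambda>t. norm (\<Sum>m\<in>N. a m * of_real (t powr \<Lambda> m)) powr q) \<in> borel_measurable (lebesgue_on {0..1})"
      by (intro measurable_restrict_space1 measurable_completion) (simp, measurable)
  qed
qed

lemma muntz_lower_bound:
  assumes \<Lambda>: "lacunary \<Lambda>" and q: "1 \<le> q"
  obtains C where "0 \<le> C"
    "\<And>M (a :: nat \<Rightarrow> 'a::{real_normed_field, euclidean_space}).
       (\<Sum>n<M. norm (a n) powr q / \<Lambda> n)
       \<le> C * (\<integral>t. norm (\<Sum>m<M. a m * of_real (t powr \<Lambda> m)) powr q \<partial>lebesgue_on {0..1})"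
proof -
  obtain r where r: "1 < r" "\<And>n. 0 < \<Lambda> n" "\<And>n. r * \<Lambda> n \<le> \<Lambda> (Suc n)"
    using lacunaryE[OF \<Lambda>] by blast
  text \<open>Shifting the exponents by \<open>1/q\<close> turns the Lebesgue measure on \<open>[0,1]\<close> into the Lebesgue
    measure on \<open>[0,\<infinity>)\<close> under \<open>t = exp (- u)\<close>.\<close>
  define l where "l n = \<Lambda> n + 1 / q" for n
  \<comment> \<open>Since \<Lambda> is increasing, the shift 1 / q is at most
    \<open>\<Lambda> n / (q * \<Lambda> 0)\<close>. Hence l and \<Lambda> are comparable, which
    later converts the weights.\<close>
  define c where "c = 1 + 1 / (q * \<Lambda> 0)"
  have c: "1 \<le> c" using q r(2)[of 0] by (simp add: c_def)
  have l_le: "l n \<le> c * \<Lambda> n" for n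
  proof -
    have "\<Lambda> 0 \<le> \<Lambda> n" using lacunary_mono[OF \<Lambda>] by simp
    then have "1 / (q * \<Lambda> 0) * \<Lambda> 0 \<le> 1 / (q * \<Lambda> 0) * \<Lambda> n" using q r by (intro mult_left_mono) (auto simp: less_imp_le)
    then show ?thesis using q r(2)[of 0] by (simp add: l_def c_def algebra_simps)
  qed
  \<comment> \<open>The increment of l is that of \<Lambda>, at least (r - 1)
    \<open>\<Lambda> n\<close>, and hence at least (r - 1) / c times \<open>l n\<close>; so l is
    again lacunary.\<close>
  define r' where "r' = 1 + (r - 1) / c"
  have r': "1 < r'" using r c by (simp add: r'_def)
  have l: "0 < l n" "r' * l n \<le> l (Suc n)" for n
  proof -
    show "0 < l n" using r(2)[of n] q by (simp add: l_def add_pos_nonneg)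
    have "(r - 1) / c * l n \<le> (r - 1) / c * (c * \<Lambda> n)" using r c l_le by (intro mult_left_mono) auto
    also have "\<dots> = (r - 1) * \<Lambda> n" using c by simp
    finally have "r' * l n \<le> l n + (r - 1) * \<Lambda> n" by (simp add: r'_def distrib_right)
    also have "\<dots> = r * \<Lambda> n + 1 / q" by (simp add: l_def algebra_simps)
    finally show "r' * l n \<le> l (Suc n)" using r(3)[of n] by (simp add: l_def)
  qed
  obtain C where C: "0 \<le> C"
    "\<And>M (a :: nat \<Rightarrow> 'a).
       integrable lborel (\<lambda>u. indicator {0..} u * norm (\<Sum>m<M. exp (- l m * u) *\<^sub>R a m) powr q) \<Longrightarrow>
       (\<Sum>n<M. norm (a n) powr q / l n)
       \<le> C * (\<integral>u. indicator {0..} u * norm (\<Sum>m<M. exp (- l m * u) *\<^sub>R a m) powr q \<partial>lborel)"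
    using exp_sum_lower_bound[where l=l and 'a='a, OF r' l q] by blast
  show thesis
  proof (rule that)
    show "0 \<le> c * C" using c C by simp
    fix M and a :: "nat \<Rightarrow> 'a"
    define h where "h t = norm (\<Sum>m<M. a m * of_real (t powr \<Lambda> m)) powr q" for t
    have h: "h \<in> borel_measurable borel" "integrable (lebesgue_on {0..1}) h"
      unfolding h_def using r(2) q by (measurable, intro integrable_muntz_polynomial_powr) auto
    \<comment> \<open>The shift contributes the common factor exp (- u / q), whose q-th power is the
      Jacobian of t = exp (- u).\<close>
    have eq: "norm (\<Sum>m<M. exp (- l m * u) *\<^sub>R a m) powr q = exp (- u) * h (exp (- u))" for u
    proof -
      have "exp (- l m * u) *\<^sub>R a m = exp (- u / q) *\<^sub>R (a m * of_real (exp (- u) powr \<Lambda> m))" for m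
      proof -
        have "exp (- l m * u) = exp (- u / q) * exp (- u) powr \<Lambda> m"
        proof -
          have "- l m * u = - u / q + - (\<Lambda> m * u)" by (simp add: l_def algebra_simps)
          then show ?thesis by (simp only: exp_add) (simp add: powr_def)
        qed
        then show ?thesis by (simp add: scaleR_conv_of_real ac_simps)
      qed
      then have "norm (\<Sum>m<M. exp (- l m * u) *\<^sub>R a m) = exp (- u / q) * norm (\<Sum>m<M. a m * of_real (exp (- u) powr \<Lambda> m))"
        by (simp add: scaleR_sum_right[symmetric])
      then show ?thesis using q by (simp add: h_def powr_mult) (simp add: powr_def)
    qed
    have lC: "(\<Sum>n<M. norm (a n) powr q / l n) \<le> C * (\<integral>t. h t \<partial>lebesgue_on {0..1})"
      using C(2)[of a M] integrable_substitution_exp[OF h] unfolding eq integral_substitution_exp[OF h] by simp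
    have "norm (a n) powr q / \<Lambda> n \<le> c * (norm (a n) powr q / l n)" for n
    proof -
      have "1 / \<Lambda> n \<le> c / l n" using l_le[of n] l(1)[of n] r(2)[of n] by (simp add: field_simps)
      from mult_left_mono[OF this, of "norm (a n) powr q"] show ?thesis by (simp add: ac_simps)
    qed
    then have "(\<Sum>n<M. norm (a n) powr q / \<Lambda> n) \<le> c * (\<Sum>n<M. norm (a n) powr q / l n)"
      unfolding sum_distrib_left by (intro sum_mono)
    also have "\<dots> \<le> c * (C * (\<integral>t. h t \<partial>lebesgue_on {0..1}))"
      using c lC by (intro mult_left_mono) auto
    finally show "(\<Sum>n<M. norm (a n) powr q / \<Lambda> n)
       \<le> c * C * (\<integral>t. norm (\<Sum>m<M. a m * of_real (t powr \<Lambda> m)) powr q \<partial>lebesgue_on {0..1})"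
      by (simp add: h_def mult.assoc)
  qed
qed

section \<open>The upper bound in \<open>L\<^sup>q(\<mu>)\<close>\<close>

text \<open>The term \<open>a n * t powr l n\<close> is split into \<open>t powr (p / q * l n)\<close>, to which \<open>(b\<^sub>p)\<close> applies, and
  \<open>t powr ((1 - p / q) * l n)\<close>, whose sum is controlled because \<open>p < q\<close>.\<close>

lemma lacunary_sum_powr_pointwise:
  fixes l a :: "nat \<Rightarrow> real" and p q t :: real
  assumes r: "1 < r" and l: "\<And>n. 0 < l n" "\<And>n. r * l n \<le> l (Suc n)"
    and a: "\<And>n. 0 \<le> a n" and pq: "0 < p" "p < q" and t: "0 \<le> t" "t \<le> 1"
  defines "\<sigma> \<equiv> min 1 ((q - p) / p) / 4"
    and "Z \<equiv> \<lambda>n. l n * t powr (p * l n)"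
  defines "c \<equiv> 1 / (1 - r powr - (\<sigma> / q))"
  shows "(\<Sum>n<N. a n * t powr l n) powr q
    \<le> 2 powr q * c powr q * (\<Sum>n<N. a n powr q / l n * (Z n + (\<Sum>m=n..<N. (l n / l m) powr (2 * \<sigma>) * (Z m + Z n))))"
proof -
  define s where "s = \<sigma> / q"
  \<comment> \<open>Of these four powers of \<sigma>, two compensate the growth
    \<open>(l m / l n) powr (2 * \<sigma>)\<close> produced by the weights and two remain as decay.
    The minimum in \<sigma> ensures \<theta> \<le> 1 and \<theta> p \<le> q - p.\<close>
  define \<theta> where "\<theta> = 4 * \<sigma>"
  have \<sigma>: "0 < \<sigma>" using pq by (simp add: \<sigma>_def)
  have \<theta>: "0 < \<theta>" "\<theta> \<le> 1" "\<theta> * p \<le> q - p"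
  proof -
    show "0 < \<theta>" "\<theta> \<le> 1" using pq by (auto simp: \<theta>_def \<sigma>_def)
    have "\<theta> \<le> (q - p) / p" by (simp add: \<theta>_def \<sigma>_def)
    then show "\<theta> * p \<le> q - p" using pq by (simp add: field_simps)
  qed
  have s: "0 < s" "s * q = \<sigma>" using \<sigma> pq by (auto simp: s_def)
  have c: "0 \<le> c" using r s by (auto simp: c_def s_def powr_minus_divide intro: ge_one_powr_ge_zero)
  have Z: "0 \<le> Z n" for n using l(1)[of n] by (simp add: Z_def)
  \<comment> \<open>The artificial powers of \<open>l n\<close> cancel in the product, as s q =
    \<sigma>. They make the sum of \<open>w m\<close> over m < n geometric.\<close>
  define w where "w n = l n powr s * t powr ((1 - p / q) * l n)" for n
  define v where "v n = a n powr q / l n * (l n powr - \<sigma> * Z n)" for n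
  have v: "0 \<le> v n" for n using l(1)[of n] Z[of n] by (simp add: v_def)
  have "(\<Sum>n<N. a n * t powr l n) powr q = (\<Sum>n<N. w n * v n powr (1 / q)) powr q"
  proof -
    have "a n * t powr l n = w n * v n powr (1 / q)" for n
    proof -
      have "v n = a n powr q * (l n powr - \<sigma> * t powr (p * l n))"
        using l(1)[of n] by (simp add: v_def Z_def)
      then have "v n powr (1 / q) = a n * l n powr - s * t powr (p / q * l n)"
        using pq a[of n] by (simp add: powr_mult powr_powr s_def)
      then have "w n * v n powr (1 / q) = a n * (l n powr s * l n powr - s) * (t powr ((1 - p / q) * l n) * t powr (p / q * l n))"
        by (simp add: w_def)
      also have "\<dots> = a n * t powr l n"
        using l(1)[of n] by (simp flip: powr_add add: algebra_simps)
      finally show ?thesis by simp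
    qed
    then show ?thesis by simp
  qed
  also have "\<dots> \<le> (\<Sum>n<N. w n) powr q * (\<Sum>n<N. (v n powr (1 / q)) powr q)"
    using pq by (intro sum_mult_powr_le) (auto simp: w_def)
  also have "\<dots> = (\<Sum>n<N. v n * (\<Sum>m<N. w m) powr q)"
    using v pq by (simp add: powr_powr sum_distrib_right mult.commute)
  also have "\<dots> \<le> (\<Sum>n<N. 2 powr q * c powr q * (a n powr q / l n * (Z n + (\<Sum>m=n..<N. (l n / l m) powr (2 * \<sigma>) * (Z m + Z n)))))"
  proof (intro sum_mono)
    fix n assume "n \<in> {..<N}"
    then have n: "n < N" by simp
    \<comment> \<open>Below n the powers of t are dropped and the last index dominates. From n on, a
      factor \<open>l m powr - s\<close> is split off to serve as summable weight, and the powers of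
      t are kept.\<close>
    have "(\<Sum>m<N. w m) = (\<Sum>m<n. w m) + (\<Sum>m=n..<N. w m)"
      using sum.atLeastLessThan_concat[of 0 n N w] n by (simp add: lessThan_atLeast0)
    also have "(\<Sum>m<n. w m) \<le> (\<Sum>m<n. l m powr s)"
      using t l pq by (intro sum_mono) (auto simp: w_def less_imp_le intro!: mult_left_le powr_le1)
    also have "\<dots> \<le> c * l n powr s"
      unfolding c_def s_def[symmetric] by (intro sum_lacunary_le r l s) auto
    finally have "(\<Sum>m<N. w m) powr q \<le> (c * l n powr s + (\<Sum>m=n..<N. w m)) powr q"
      using pq by (intro powr_mono2) (auto simp: w_def intro!: sum_nonneg)
    also have "\<dots> \<le> 2 powr q * ((c * l n powr s) powr q + (\<Sum>m=n..<N. w m) powr q)"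
      using pq c by (intro add_powr_le) (auto simp: w_def intro!: sum_nonneg)
    also have "(c * l n powr s) powr q = c powr q * l n powr \<sigma>"
      using c by (simp add: powr_mult powr_powr s)
    also have "(\<Sum>m=n..<N. w m) = (\<Sum>m=n..<N. l m powr - s * (l m powr (2 * s) * t powr ((1 - p / q) * l m)))"
      using l(1) by (intro sum.cong refl) (auto simp: w_def less_imp_neq[symmetric] simp flip: powr_add mult.assoc)
    also have "\<dots> powr q \<le> (\<Sum>m=n..<N. l m powr - s) powr q * (\<Sum>m=n..<N. (l m powr (2 * s) * t powr ((1 - p / q) * l m)) powr q)"
      using pq by (intro sum_mult_powr_le) auto
    also have "\<dots> \<le> (c * l n powr - s) powr q * (\<Sum>m=n..<N. (l m powr (2 * s) * t powr ((1 - p / q) * l m)) powr q)"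
      unfolding c_def s_def[symmetric] using pq
      by (intro mult_right_mono powr_mono2 sum_lacunary_inverse_le r l s sum_nonneg) auto
    also have "\<dots> = c powr q * l n powr - \<sigma> * (\<Sum>m=n..<N. l m powr (2 * \<sigma>) * t powr ((q - p) * l m))"
    proof -
      have "(l m powr (2 * s) * t powr ((1 - p / q) * l m)) powr q = l m powr (2 * \<sigma>) * t powr ((q - p) * l m)" for m
      proof -
        have "(1 - p / q) * l m * q = (q - p) * l m" using pq by (simp add: field_simps)
        moreover have "2 * s * q = 2 * \<sigma>" using s by simp
        ultimately show ?thesis by (simp only: powr_mult powr_powr)
      qed
      moreover have "(c * l n powr - s) powr q = c powr q * l n powr - \<sigma>"
        using s by (simp add: powr_mult powr_powr)
      ultimately show ?thesis by (simp only:)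
    qed
    finally have "(\<Sum>m<N. w m) powr q \<le> 2 powr q * (c powr q * l n powr \<sigma> +
        c powr q * l n powr - \<sigma> * (\<Sum>m=n..<N. l m powr (2 * \<sigma>) * t powr ((q - p) * l m)))" by simp
    also have "\<dots> = 2 powr q * c powr q * (l n powr \<sigma> +
        l n powr - \<sigma> * (\<Sum>m=n..<N. l m powr (2 * \<sigma>) * t powr ((q - p) * l m)))" by (simp add: algebra_simps)
    finally have "v n * (\<Sum>m<N. w m) powr q \<le> v n * (2 powr q * c powr q * (l n powr \<sigma> +
        l n powr - \<sigma> * (\<Sum>m=n..<N. l m powr (2 * \<sigma>) * t powr ((q - p) * l m))))"
      by (intro mult_left_mono v)
    also have "\<dots> = 2 powr q * c powr q * (a n powr q / l n * (Z n * (l n powr - \<sigma> * l n powr \<sigma>)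
        + (\<Sum>m=n..<N. l n powr - \<sigma> * l n powr - \<sigma> * (l m powr (2 * \<sigma>) * (Z n * t powr ((q - p) * l m))))))"
      by (simp add: v_def sum_distrib_left algebra_simps)
    also have "\<dots> \<le> 2 powr q * c powr q * (a n powr q / l n * (Z n + (\<Sum>m=n..<N. (l n / l m) powr (2 * \<sigma>) * (Z m + Z n))))"
    proof (intro mult_left_mono add_mono sum_mono)
      show "Z n * (l n powr - \<sigma> * l n powr \<sigma>) \<le> Z n"
        using l(1)[of n] by (simp flip: powr_add)
      fix m assume "m \<in> {n..<N}"
      \<comment> \<open>Interpolation: part of the power of t in \<open>Z n\<close> is discarded, as
        is part of the spare power at m, so that a geometric mean of \<open>Z n\<close> and
        \<open>Z m\<close> with exponents 1 - \<theta> and \<theta> remains. The factors l outside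
        produce the ratio.\<close>
      have "Z n * t powr ((q - p) * l m) \<le> (l n / l m) powr \<theta> * (Z m + Z n)"
      proof (cases "t = 0")
        case True
        then show ?thesis by (simp add: Z_def)
      next
        case False
        then have t: "0 < t" "t \<le> 1" using t by auto
        have Zpos: "0 < Z k" for k using t l(1)[of k] by (simp add: Z_def)
        have "t powr ((q - p) * l m) \<le> t powr (\<theta> * p * l m)"
          using t \<theta> l(1)[of m] by (intro powr_mono') (auto intro!: mult_right_mono simp: less_imp_le)
        moreover have "t powr (p * l n) \<le> t powr ((1 - \<theta>) * (p * l n))"
          using t \<theta> l(1)[of n] pq by (intro powr_mono') (auto intro!: mult_left_le_one_le simp: less_imp_le)
        ultimately have "Z n * t powr ((q - p) * l m) \<le> l n * t powr ((1 - \<theta>) * (p * l n)) * t powr (\<theta> * p * l m)"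
          unfolding Z_def using l(1)[of n] by (intro mult_mono mult_left_mono) auto
        also have "\<dots> = l n * (Z n / l n) powr (1 - \<theta>) * (Z m / l m) powr \<theta>"
          using l(1)[of n] l(1)[of m] by (simp add: Z_def powr_powr mult_ac)
        also have "\<dots> = (l n / l m) powr \<theta> * (Z n powr (1 - \<theta>) * Z m powr \<theta>)"
          using l(1)[of n] l(1)[of m] Z by (simp add: powr_divide less_imp_le powr_diff mult_ac)
        also have "\<dots> \<le> (l n / l m) powr \<theta> * ((Z m + Z n) powr (1 - \<theta>) * (Z m + Z n) powr \<theta>)"
          using \<theta> Z by (intro mult_left_mono mult_mono powr_mono2) auto
        also have "\<dots> = (l n / l m) powr \<theta> * (Z m + Z n)"
          using Zpos[of n] Zpos[of m] by (simp flip: powr_add)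
        finally show ?thesis .
      qed
      then have "l n powr - \<sigma> * l n powr - \<sigma> * (l m powr (2 * \<sigma>) * (Z n * t powr ((q - p) * l m)))
          \<le> l n powr - \<sigma> * l n powr - \<sigma> * (l m powr (2 * \<sigma>) * ((l n / l m) powr \<theta> * (Z m + Z n)))"
        by (intro mult_left_mono) auto
      also have "\<dots> = (l n / l m) powr (2 * \<sigma>) * (Z m + Z n)"
      proof -
        have "l n powr - \<sigma> * l n powr - \<sigma> * l m powr (2 * \<sigma>) = (l n / l m) powr - (2 * \<sigma>)"
        proof -
          have "l n powr - \<sigma> * l n powr - \<sigma> = l n powr - (2 * \<sigma>)" by (simp flip: powr_add)
          then show ?thesis
            unfolding powr_minus_divide using l(1)[of n] l(1)[of m] by (simp add: powr_divide)
        qed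
        then have "l n powr - \<sigma> * l n powr - \<sigma> * l m powr (2 * \<sigma>) * (l n / l m) powr \<theta> = (l n / l m) powr (2 * \<sigma>)"
          by (simp add: \<theta>_def flip: powr_add)
        then show ?thesis by (simp only: mult.assoc[symmetric])
      qed
      finally show "l n powr - \<sigma> * l n powr - \<sigma> * (l m powr (2 * \<sigma>) * (Z n * t powr ((q - p) * l m)))
          \<le> (l n / l m) powr (2 * \<sigma>) * (Z m + Z n)" .
    qed (use l(1)[of n] in auto)
    finally show "v n * (\<Sum>m<N. w m) powr q
        \<le> 2 powr q * c powr q * (a n powr q / l n * (Z n + (\<Sum>m=n..<N. (l n / l m) powr (2 * \<sigma>) * (Z m + Z n))))" .
  qed
  also have "\<dots> = 2 powr q * c powr q * (\<Sum>n<N. a n powr q / l n * (Z n + (\<Sum>m=n..<N. (l n / l m) powr (2 * \<sigma>) * (Z m + Z n))))"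
    by (simp add: sum_distrib_left)
  finally show ?thesis .
qed

lemma borel_measurable_01:
  assumes "sets \<mu> = sets (restrict_space borel {0..<1::real})" "f \<in> borel_measurable borel"
  shows "f \<in> borel_measurable \<mu>"
  using measurable_restrict_space1[OF assms(2), of "{0..<1}"] measurable_cong_sets[OF assms(1) refl] by blast

lemma space_01:
  assumes "sets \<mu> = sets (restrict_space borel {0..<1::real})"
  shows "space \<mu> = {0..<1}"
  using sets_eq_imp_space_eq[OF assms] by (simp add: space_restrict_space)

text \<open>Integrating the pointwise estimate, every integral attached to n has index m \<ge> n and
  is at most \<open>e n\<close>. The term of n itself gives 1, and the lacunary sum over m gives 2
  d, as it carries both \<open>Z m\<close> and \<open>Z n\<close>.\<close>

lemma integral_lacunary_sum_powr_le:
  fixes l :: "nat \<Rightarrow> real"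
  assumes r: "1 < r" and l: "\<And>n. 0 < l n" "\<And>n. r * l n \<le> l (Suc n)" and pq: "0 < p" "p < q"
    and \<mu>: "finite_measure \<mu>" "sets \<mu> = sets (restrict_space borel {0..<1::real})"
    and e: "\<And>n m. n \<le> m \<Longrightarrow> l m * (\<integral>t. t powr (p * l m) \<partial>\<mu>) \<le> e n"
  obtains C where "0 \<le> C"
    "\<And>a N. (\<And>n. 0 \<le> a n) \<Longrightarrow> integrable \<mu> (\<lambda>t. (\<Sum>n<N. a n * t powr l n) powr q) \<and>
      (\<integral>t. (\<Sum>n<N. a n * t powr l n) powr q \<partial>\<mu>) \<le> C * (\<Sum>n<N. a n powr q / l n * e n)"
proof -
  interpret finite_measure \<mu> by (rule \<mu>)
  define \<sigma> where "\<sigma> = min 1 ((q - p) / p) / 4"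
  define c where "c = 1 / (1 - r powr - (\<sigma> / q))"
  define d where "d = 1 / (1 - r powr - (2 * \<sigma>))"
  have \<sigma>: "0 < \<sigma>" using pq by (simp add: \<sigma>_def)
  then have d: "0 \<le> d" using r by (auto simp: d_def powr_minus_divide intro: ge_one_powr_ge_zero)
  define Z where "Z m t = l m * t powr (p * l m)" for m t
  have t01: "t \<in> space \<mu> \<Longrightarrow> 0 \<le> t \<and> t \<le> 1" for t using space_01[OF \<mu>(2)] by auto
  have int_powr: "integrable \<mu> (\<lambda>t. t powr (p * l m))" for m
    using t01 l pq
    by (intro integrable_const_bound[where B=1] borel_measurable_01[OF \<mu>(2)] AE_I2)
       (auto intro!: powr_le1 simp: less_imp_le)
  have Z: "integrable \<mu> (Z m)" "n \<le> m \<Longrightarrow> (\<integral>t. Z m t \<partial>\<mu>) \<le> e n" for n m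
    unfolding Z_def using e int_powr by auto
  show thesis
  proof (rule that)
    show "0 \<le> 2 powr q * c powr q * (1 + 2 * d)" using d by simp
    fix a :: "nat \<Rightarrow> real" and N assume a: "\<And>n. 0 \<le> a n"
    define h where "h t = 2 powr q * c powr q * (\<Sum>n<N. a n powr q / l n * (Z n t + (\<Sum>m=n..<N. (l n / l m) powr (2 * \<sigma>) * (Z m t + Z n t))))" for t
    have "has_bochner_integral \<mu> h (2 powr q * c powr q * (\<Sum>n<N. a n powr q / l n *
        ((\<integral>t. Z n t \<partial>\<mu>) + (\<Sum>m=n..<N. (l n / l m) powr (2 * \<sigma>) * ((\<integral>t. Z m t \<partial>\<mu>) + (\<integral>t. Z n t \<partial>\<mu>))))))"
      unfolding h_def
      by (intro has_bochner_integral_mult_right has_bochner_integral_sum has_bochner_integral_add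
          has_bochner_integral_integrable Z(1))
    then have h: "integrable \<mu> h"
      and h_eq: "(\<integral>t. h t \<partial>\<mu>) = 2 powr q * c powr q * (\<Sum>n<N. a n powr q / l n *
        ((\<integral>t. Z n t \<partial>\<mu>) + (\<Sum>m=n..<N. (l n / l m) powr (2 * \<sigma>) * ((\<integral>t. Z m t \<partial>\<mu>) + (\<integral>t. Z n t \<partial>\<mu>)))))"
      unfolding has_bochner_integral_iff by blast+
    have le: "(\<Sum>n<N. a n * t powr l n) powr q \<le> h t" if "t \<in> space \<mu>" for t
      unfolding h_def Z_def \<sigma>_def c_def using t01[OF that] by (intro lacunary_sum_powr_pointwise r l a pq) auto
    have int: "integrable \<mu> (\<lambda>t. (\<Sum>n<N. a n * t powr l n) powr q)"
    proof (rule Bochner_Integration.integrable_bound[OF h])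
      show "AE t in \<mu>. norm ((\<Sum>n<N. a n * t powr l n) powr q) \<le> norm (h t)"
        using le by (intro AE_I2) (auto intro: order.trans[OF _ abs_ge_self])
    qed (intro borel_measurable_01[OF \<mu>(2)], measurable)
    have "(\<integral>t. (\<Sum>n<N. a n * t powr l n) powr q \<partial>\<mu>) \<le> (\<integral>t. h t \<partial>\<mu>)"
      by (intro integral_mono int h le)
    also have "\<dots> \<le> 2 powr q * c powr q * (\<Sum>n<N. a n powr q / l n * ((1 + 2 * d) * e n))"
      unfolding h_eq
    proof (intro mult_left_mono sum_mono)
      fix n
      have e0: "0 \<le> e n"
        using l(1)[of n] by (intro order.trans[OF _ e[of n n]] mult_nonneg_nonneg integral_nonneg_AE) auto
      have "(\<Sum>m=n..<N. (l n / l m) powr (2 * \<sigma>)) = l n powr (2 * \<sigma>) * (\<Sum>m=n..<N. l m powr - (2 * \<sigma>))"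
        unfolding sum_distrib_left using l by (intro sum.cong refl) (simp add: powr_divide less_imp_le powr_minus_divide)
      also have "\<dots> \<le> l n powr (2 * \<sigma>) * (d * l n powr - (2 * \<sigma>))"
        unfolding d_def using \<sigma> by (intro mult_left_mono sum_lacunary_inverse_le r l) auto
      also have "\<dots> = d" using l(1)[of n] by (simp flip: powr_add)
      finally have "(\<Sum>m=n..<N. (l n / l m) powr (2 * \<sigma>)) * (2 * e n) \<le> d * (2 * e n)"
        using e0 by (intro mult_right_mono) auto
      moreover have "(\<Sum>m=n..<N. (l n / l m) powr (2 * \<sigma>) * ((\<integral>t. Z m t \<partial>\<mu>) + (\<integral>t. Z n t \<partial>\<mu>)))
          \<le> (\<Sum>m=n..<N. (l n / l m) powr (2 * \<sigma>) * (e n + e n))"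
        using Z(2)[of n] by (intro sum_mono mult_left_mono add_mono) auto
      moreover have "(\<Sum>m=n..<N. (l n / l m) powr (2 * \<sigma>) * (e n + e n))
          = (\<Sum>m=n..<N. (l n / l m) powr (2 * \<sigma>)) * (2 * e n)"
        by (simp only: sum_distrib_right mult_2)
      moreover have "(1 + 2 * d) * e n = e n + d * (2 * e n)" by (simp add: algebra_simps)
      ultimately show "(\<integral>t. Z n t \<partial>\<mu>) + (\<Sum>m=n..<N. (l n / l m) powr (2 * \<sigma>) * ((\<integral>t. Z m t \<partial>\<mu>) + (\<integral>t. Z n t \<partial>\<mu>)))
          \<le> (1 + 2 * d) * e n"
        using Z(2)[of n n] by linarith
    qed (use l in \<open>auto simp: less_imp_le\<close>)
    also have "\<dots> = 2 powr q * c powr q * (1 + 2 * d) * (\<Sum>n<N. a n powr q / l n * e n)"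
      by (simp add: sum_distrib_left mult_ac)
    finally show "integrable \<mu> (\<lambda>t. (\<Sum>n<N. a n * t powr l n) powr q) \<and>
      (\<integral>t. (\<Sum>n<N. a n * t powr l n) powr q \<partial>\<mu>) \<le> 2 powr q * c powr q * (1 + 2 * d) * (\<Sum>n<N. a n powr q / l n * e n)"
      using int by simp
  qed
qed

section \<open>Muntz spaces as spaces of series\<close>

text \<open>Takes the coefficients as an argument, so that series can be handled before their
  coefficients are identified with \<open>muntz_coeffs\<close>.\<close>

definition muntz_series ::
    "(nat \<Rightarrow> real) \<Rightarrow> (nat \<Rightarrow> 'a::{real_normed_field, euclidean_space}) \<Rightarrow> real \<Rightarrow> 'a" where
  "muntz_series \<Lambda> a x = (\<Sum>n. a n * of_real (x powr \<Lambda> n))"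

lemma borel_measurable_muntz_series [measurable]: "muntz_series \<Lambda> a \<in> borel_measurable borel"
  unfolding muntz_series_def[abs_def] by measurable

lemma lacunary_ge_geometric:
  assumes "lacunary \<Lambda>"
  obtains r where "1 < r" "\<And>n. r ^ n * \<Lambda> 0 \<le> \<Lambda> n" "\<And>n. 0 < \<Lambda> n"
proof -
  obtain r where r: "1 < r" "\<And>n. 0 < \<Lambda> n" "\<And>n. r * \<Lambda> n \<le> \<Lambda> (Suc n)"
    using lacunaryE[OF assms] by blast
  then show thesis using geometric_le[of r \<Lambda> 0] that by simp
qed

lemma filterlim_lacunary:
  assumes "lacunary \<Lambda>"
  shows "filterlim \<Lambda> at_top sequentially"
proof -
  obtain r where r: "1 < r" "\<And>n. r ^ n * \<Lambda> 0 \<le> \<Lambda> n" "\<And>n. 0 < \<Lambda> n"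
    using lacunary_ge_geometric[OF assms] by blast
  have "filterlim (\<lambda>n. r ^ n) at_top sequentially" using r(1) by real_asymp
  then have "filterlim (\<lambda>n. r ^ n * \<Lambda> 0) at_top sequentially"
    by (rule filterlim_at_top_mult_tendsto_pos[OF tendsto_const r(3)])
  then show ?thesis by (rule filterlim_at_top_mono) (use r in auto)
qed

text \<open>Even with an extra factor \<open>\<Lambda> n\<close> the terms tend to 0, since x powr y
  beats every power of y. So they are eventually below 1 / \<open>\<Lambda> n\<close>, which is
  geometrically small. At x = 0 all terms are 0.\<close>

lemma summable_lacunary_powr:
  assumes \<Lambda>: "lacunary \<Lambda>" and x: "0 \<le> x" "x < 1"
  shows "summable (\<lambda>n. \<Lambda> n powr s * x powr \<Lambda> n)"
proof (cases "x = 0")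
  case False
  then have x: "0 < x" "x < 1" using x by auto
  obtain r where r: "1 < r" "\<And>n. r ^ n * \<Lambda> 0 \<le> \<Lambda> n" "\<And>n. 0 < \<Lambda> n"
    using lacunary_ge_geometric[OF \<Lambda>] by blast
  have "((\<lambda>y. y powr (s + 1) * x powr y) \<longlongrightarrow> 0) at_top"
    using x by real_asymp
  then have "((\<lambda>n. \<Lambda> n powr (s + 1) * x powr \<Lambda> n) \<longlongrightarrow> 0) sequentially"
    using filterlim_lacunary[OF \<Lambda>] by (rule filterlim_compose)
  then have ev: "eventually (\<lambda>n. \<Lambda> n powr (s + 1) * x powr \<Lambda> n < 1) sequentially"
    by (rule order_tendstoD) auto
  have "summable (\<lambda>n. (1 / r) ^ n * (1 / \<Lambda> 0))"
    using r by (intro summable_mult2 summable_geometric) auto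
  then show ?thesis
  proof (rule summable_comparison_test_ev[rotated])
    show "eventually (\<lambda>n. norm (\<Lambda> n powr s * x powr \<Lambda> n) \<le> (1 / r) ^ n * (1 / \<Lambda> 0)) sequentially"
      using ev
    proof eventually_elim
      case (elim n)
      have "\<Lambda> n powr s * x powr \<Lambda> n * \<Lambda> n \<le> 1"
        using elim r(3)[of n] by (simp add: powr_add mult_ac)
      then have "\<Lambda> n powr s * x powr \<Lambda> n \<le> 1 / \<Lambda> n" using r(3)[of n] by (simp add: field_simps)
      also have "\<dots> \<le> 1 / (r ^ n * \<Lambda> 0)" using r by (intro divide_left_mono) (auto intro!: mult_pos_pos)
      finally show ?case using r by (simp add: power_one_over)
    qed
  qed
qed simp

text \<open>The weight \<open>\<Lambda> n powr (1 / q)\<close> is the growth that a bound on the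
  weighted l^q sum permits for the n-th coefficient.\<close>

definition muntz_majorant :: "(nat \<Rightarrow> real) \<Rightarrow> real \<Rightarrow> real \<Rightarrow> real" where
  "muntz_majorant \<Lambda> q x = (\<Sum>n. \<Lambda> n powr (1 / q) * x powr \<Lambda> n)"

lemma
  fixes a :: "nat \<Rightarrow> 'a::{real_normed_field, euclidean_space}"
  assumes \<Lambda>: "lacunary \<Lambda>" and x: "0 \<le> x" "x < 1"
    and a: "\<And>n. norm (a n) \<le> B * \<Lambda> n powr (1 / q)"
  shows summable_muntz_series: "summable (\<lambda>n. a n * of_real (x powr \<Lambda> n))"
    and norm_muntz_series_le: "norm (muntz_series \<Lambda> a x) \<le> B * muntz_majorant \<Lambda> q x"
proof -
  have *: "summable (\<lambda>n. B * (\<Lambda> n powr (1 / q) * x powr \<Lambda> n))"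
    by (intro summable_mult summable_lacunary_powr \<Lambda> x)
  have le: "norm (a n * of_real (x powr \<Lambda> n)) \<le> B * (\<Lambda> n powr (1 / q) * x powr \<Lambda> n)" for n
    using mult_right_mono[OF a[of n], of "x powr \<Lambda> n"] by (simp add: norm_mult mult.assoc)
  show "summable (\<lambda>n. a n * of_real (x powr \<Lambda> n))"
    by (rule summable_comparison_test'[OF *]) (rule le)
  have "norm (muntz_series \<Lambda> a x) \<le> (\<Sum>n. B * (\<Lambda> n powr (1 / q) * x powr \<Lambda> n))"
    unfolding muntz_series_def by (intro norm_suminf_le * le)
  also have "\<dots> = B * muntz_majorant \<Lambda> q x"
    unfolding muntz_majorant_def by (intro suminf_mult summable_lacunary_powr \<Lambda> x)
  finally show "norm (muntz_series \<Lambda> a x) \<le> B * muntz_majorant \<Lambda> q x" .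
qed

section \<open>Fatou's lemma and identification of Muntz spaces\<close>

text \<open>Upgrades pointwise convergence with bounded norms to membership of the limit. It serves
  both on [0,1], for limits of polynomials, and in L^q(\<mu>), for partial sums of series.\<close>

lemma Lp_functions_Fatou:
  fixes f :: "nat \<Rightarrow> 'b \<Rightarrow> 'a::{real_normed_field, euclidean_space}"
  assumes q: "0 < q" and f: "\<And>k. f k \<in> Lp_functions q M"
    and g: "g \<in> borel_measurable M" and lim: "AE x in M. (\<lambda>k. f k x) \<longlonglongrightarrow> g x"
    and D: "\<And>k. (\<integral>x. norm (f k x) powr q \<partial>M) \<le> D"
  shows "g \<in> Lp_functions q M" "(\<integral>x. norm (g x) powr q \<partial>M) \<le> D"
proof -
  note [measurable] = g Lp_functionsD(1)[OF f]
  have D0: "0 \<le> D" by (rule order.trans[OF integral_nonneg_AE D]) auto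
  have "(\<integral>\<^sup>+x. ennreal (norm (g x) powr q) \<partial>M) = (\<integral>\<^sup>+x. liminf (\<lambda>k. ennreal (norm (f k x) powr q)) \<partial>M)"
  proof (rule nn_integral_cong_AE)
    show "AE x in M. ennreal (norm (g x) powr q) = liminf (\<lambda>k. ennreal (norm (f k x) powr q))"
      using lim
    proof eventually_elim
      case (elim x)
      then have "(\<lambda>k. norm (f k x) powr q) \<longlonglongrightarrow> norm (g x) powr q"
        using q by (intro tendsto_powr' tendsto_norm tendsto_const) auto
      then show ?case by (intro lim_imp_Liminf[symmetric] tendsto_ennrealI) auto
    qed
  qed
  also have "\<dots> \<le> liminf (\<lambda>k. \<integral>\<^sup>+x. ennreal (norm (f k x) powr q) \<partial>M)"
    by (intro nn_integral_liminf) measurable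
  also have "\<dots> \<le> ennreal D"
  proof -
    have "(\<integral>\<^sup>+x. ennreal (norm (f k x) powr q) \<partial>M) \<le> ennreal D" for k
      using D[of k] Lp_functionsD(2)[OF f] by (subst nn_integral_eq_integral) (auto intro: ennreal_leI)
    then have "liminf (\<lambda>k. \<integral>\<^sup>+x. ennreal (norm (f k x) powr q) \<partial>M) \<le> liminf (\<lambda>k::nat. ennreal D)"
      by (intro Liminf_mono) auto
    then show ?thesis by (simp add: Liminf_const)
  qed
  finally have le: "(\<integral>\<^sup>+x. ennreal (norm (g x) powr q) \<partial>M) \<le> ennreal D" .
  then have int: "integrable M (\<lambda>x. norm (g x) powr q)"
    by (intro integrableI_bounded) (auto intro: le_less_trans[OF _ ennreal_less_top])
  then show "g \<in> Lp_functions q M" using g by (simp add: Lp_functions_def)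
  show "(\<integral>x. norm (g x) powr q \<partial>M) \<le> D"
    using le D0 nn_integral_eq_integral[OF int] by simp
qed

lemma Lp_seminorm_powr:
  assumes "0 < q"
  shows "Lp_seminorm q M f powr q = (\<integral>x. norm (f x) powr q \<partial>M)"
  using assms integral_nonneg_AE[where M=M and f="\<lambda>x. norm (f x) powr q"] by (simp add: Lp_seminorm_def powr_powr)

lemma Lp_seminorm_nonneg: "0 \<le> Lp_seminorm q M f"
  by (simp add: Lp_seminorm_def)

lemma Lp_seminorm_le_iff:
  assumes "0 < q" "0 \<le> e"
  shows "Lp_seminorm q M f \<le> e \<longleftrightarrow> (\<integral>x. norm (f x) powr q \<partial>M) \<le> e powr q"
  using assms Lp_seminorm_nonneg[of q M f] unfolding Lp_seminorm_powr[OF assms(1), symmetric]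
  by (metis not_le powr_less_mono2 powr_mono2 less_imp_le)

lemma Lp_seminorm_minus_commute:
  "Lp_seminorm q M (\<lambda>x. f x - g x) = Lp_seminorm q M (\<lambda>x. g x - f x)"
  by (simp add: Lp_seminorm_def norm_minus_commute)

lemma Lp_seminorm_diff_triangle:
  assumes "1 \<le> q" "f \<in> Lp_functions q M" "g \<in> Lp_functions q M" "h \<in> Lp_functions q M"
  shows "Lp_seminorm q M (\<lambda>x. f x - h x) \<le> Lp_seminorm q M (\<lambda>x. f x - g x) + Lp_seminorm q M (\<lambda>x. g x - h x)"
  using Lp_seminorm_triangle[OF assms(1) Lp_functions_diff[OF assms(1-3)] Lp_functions_diff[OF assms(1,3,4)]]
  by simp

text \<open>The coefficients of a sequence of polynomials converging in \<open>L\<^sup>q\<close> converge by the lower bound;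
  Fatou's lemma identifies the limit series with the \<open>L\<^sup>q\<close> limit.\<close>

lemma muntz_space_series:
  fixes F :: "(real \<Rightarrow> 'a::{real_normed_field, euclidean_space}) set"
  assumes \<Lambda>: "lacunary \<Lambda>" and q: "1 \<le> q" and F: "F \<in> muntz_space \<Lambda> q" and C: "0 \<le> C"
    and lower: "\<And>M (a :: nat \<Rightarrow> 'a). (\<Sum>n<M. norm (a n) powr q / \<Lambda> n)
       \<le> C * (\<integral>t. norm (\<Sum>m<M. a m * of_real (t powr \<Lambda> m)) powr q \<partial>lebesgue_on {0..1})"
  obtains a where "\<And>M. (\<Sum>n<M. norm (a n) powr q / \<Lambda> n) \<le> C * Lp_norm q (lebesgue_on {0..1}) F powr q"
    "muntz_series \<Lambda> a \<in> F"
proof -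
  let ?M = "lebesgue_on {0..1::real}"
  have \<Lambda>0: "0 < \<Lambda> n" for n using \<Lambda> by (auto simp: lacunary_def)
  have q0: "0 < q" using q by simp
  interpret L: Metric_space "Lp_space q ?M :: (real \<Rightarrow> 'a) set set" "Lp_dist q ?M"
    by (rule Metric_space_Lp[OF q])
  have poly_Lp: "f \<in> Lp_functions q ?M" if "f \<in> muntz_polynomials \<Lambda>" for f :: "real \<Rightarrow> 'a"
    using that q0 \<Lambda>0 unfolding muntz_polynomials_def Lp_functions_def
    by (auto intro!: integrable_muntz_polynomial_powr measurable_restrict_space1 measurable_completion)
  have F': "F \<in> Lp_space q ?M"
      "\<forall>r>0. \<exists>y\<in>Lp_class q ?M ` muntz_polynomials \<Lambda>. y \<in> L.mball F r"
    using F unfolding muntz_space_def Lp_topology_def L.metric_closure_of by auto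
  obtain f0 where f0: "f0 \<in> Lp_functions q ?M" "F = Lp_class q ?M f0" using F'(1) by (auto simp: Lp_space_def)
  define G where "G k N a \<longleftrightarrow> finite N \<and>
      Lp_seminorm q ?M (\<lambda>x. f0 x - (\<Sum>n\<in>N. a n * of_real (x powr \<Lambda> n))) < 1 / real (Suc k)"
    for k N and a :: "nat \<Rightarrow> 'a"
  have "\<exists>N a. G k N a" for k
  proof -
    obtain f where f: "f \<in> muntz_polynomials \<Lambda>" "Lp_dist q ?M F (Lp_class q ?M f) < 1 / real (Suc k)"
      using F'(2)[rule_format, of "1 / real (Suc k)"] by auto
    then have "Lp_seminorm q ?M (\<lambda>x. f0 x - f x) < 1 / real (Suc k)"
      using Lp_dist_class[OF f0(1) poly_Lp[OF f(1)]] f0(2) by simp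
    then show ?thesis using f(1) unfolding muntz_polynomials_def G_def by auto
  qed
  then obtain N a where "\<And>k. G k (N k) (a k)" by metis
  then have aN: "\<And>k. finite (N k)"
      "\<And>k. Lp_seminorm q ?M (\<lambda>x. f0 x - (\<Sum>n\<in>N k. a k n * of_real (x powr \<Lambda> n))) < 1 / real (Suc k)"
    by (auto simp: G_def)
  \<comment> \<open>Extension by 0 lets polynomials with different index sets be subtracted
    coefficientwise over a common initial segment.\<close>
  define c where "c k n = (if n \<in> N k then a k n else 0)" for k n
  define f where "f k x = (\<Sum>n\<in>N k. a k n * of_real (x powr \<Lambda> n))" for k x
  have f_Lp: "f k \<in> Lp_functions q ?M" for k
    using aN(1) by (intro poly_Lp) (auto simp: muntz_polynomials_def f_def[abs_def])
  have f_close: "Lp_seminorm q ?M (\<lambda>x. f0 x - f k x) < 1 / real (Suc k)" for k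
    using aN(2)[of k] by (simp add: f_def)
  have f_sum: "f k x = (\<Sum>n<M. c k n * of_real (x powr \<Lambda> n))" if "N k \<subseteq> {..<M}" for k M x
    unfolding f_def c_def using that by (intro sum.mono_neutral_cong_left) auto
  have f_series: "(\<lambda>n. c k n * of_real (x powr \<Lambda> n)) sums f k x" for k x
  proof -
    have "(\<lambda>n. c k n * of_real (x powr \<Lambda> n)) sums (\<Sum>n\<in>N k. c k n * of_real (x powr \<Lambda> n))"
      using aN(1) by (intro sums_finite) (auto simp: c_def)
    then show ?thesis by (simp add: f_def c_def)
  qed
  have bound: "\<exists>M. N k \<subseteq> {..<M}" for k
    using finite_nat_bounded[OF aN(1)] by blast
  have lowerf: "(\<Sum>n<M. norm (c k n) powr q / \<Lambda> n) \<le> C * Lp_seminorm q ?M (f k) powr q" for k M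
  proof -
    obtain M' where M': "N k \<subseteq> {..<M'}" using bound by blast
    then have M'': "N k \<subseteq> {..<max M M'}" by auto
    have "(\<Sum>n<M. norm (c k n) powr q / \<Lambda> n) \<le> (\<Sum>n<max M M'. norm (c k n) powr q / \<Lambda> n)"
      using \<Lambda>0 by (intro sum_mono2) (auto simp: less_imp_le)
    also have "\<dots> \<le> C * Lp_seminorm q ?M (f k) powr q"
      using lower[of "c k" "max M M'"] by (simp add: Lp_seminorm_powr[OF q0] f_sum[OF M''])
    finally show ?thesis .
  qed
  have lowerd: "norm (c k n - c j n) powr q / \<Lambda> n \<le> C * Lp_seminorm q ?M (\<lambda>x. f k x - f j x) powr q" for k j n
  proof -
    obtain M1 M2 where M': "N k \<subseteq> {..<M1}" "N j \<subseteq> {..<M2}" using bound by metis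
    define M where "M = max (Suc n) (max M1 M2)"
    have M: "N k \<subseteq> {..<M}" "N j \<subseteq> {..<M}" "n < M" using M' by (auto simp: M_def)
    have "norm (c k n - c j n) powr q / \<Lambda> n \<le> (\<Sum>n<M. norm (c k n - c j n) powr q / \<Lambda> n)"
      using \<Lambda>0 M by (intro member_le_sum) (auto simp: less_imp_le)
    also have "\<dots> \<le> C * Lp_seminorm q ?M (\<lambda>x. f k x - f j x) powr q"
      using lower[of "\<lambda>n. c k n - c j n" M]
      by (simp add: Lp_seminorm_powr[OF q0] f_sum[OF M(1)] f_sum[OF M(2)] sum_subtractf left_diff_distrib)
    finally show ?thesis .
  qed
  \<comment> \<open>A bound, extracted from the lower estimate, for the n-th coefficient functional
    on polynomials with respect to the L^q norm.\<close>
  define B where "B n = (C * \<Lambda> n) powr (1 / q)" for n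
  have lowerc: "norm (c k n - c j n) \<le> B n * Lp_seminorm q ?M (\<lambda>x. f k x - f j x)" for k j n
  proof -
    have "norm (c k n - c j n) powr q \<le> C * \<Lambda> n * Lp_seminorm q ?M (\<lambda>x. f k x - f j x) powr q"
      using lowerd[of k n j] \<Lambda>0[of n] by (simp add: field_simps)
    then have "(norm (c k n - c j n) powr q) powr (1 / q) \<le> (C * \<Lambda> n * Lp_seminorm q ?M (\<lambda>x. f k x - f j x) powr q) powr (1 / q)"
      using q by (intro powr_mono2) auto
    then show ?thesis using q C \<Lambda>0[of n] Lp_seminorm_nonneg[of q ?M "\<lambda>x. f k x - f j x"]
      by (simp add: powr_powr powr_mult B_def)
  qed
  have f_dist: "Lp_seminorm q ?M (\<lambda>x. f k x - f j x) \<le> 1 / real (Suc k) + 1 / real (Suc j)" for k j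
    using Lp_seminorm_diff_triangle[OF q f_Lp[of k] f0(1) f_Lp[of j]] f_close[of k] f_close[of j]
      Lp_seminorm_minus_commute[of q ?M "f k" f0] by simp
  have f_dist': "Lp_seminorm q ?M (\<lambda>x. f k x - f j x) \<le> 2 / real (Suc i)" if "i \<le> k" "i \<le> j" for i j k
  proof -
    have "1 / real (Suc k) \<le> 1 / real (Suc i)" "1 / real (Suc j) \<le> 1 / real (Suc i)"
      using that by (auto intro!: divide_left_mono)
    with f_dist[of k j] show ?thesis by simp
  qed
  have null: "(\<lambda>i. K * (2 / real (Suc i))) \<longlonglongrightarrow> 0" for K by real_asymp
  have "\<exists>l. (\<lambda>k. c k n) \<longlonglongrightarrow> l" for n
  proof -
    have "Cauchy (\<lambda>k. c k n)"
    proof (rule metric_CauchyI)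
      fix e :: real assume "0 < e"
      then have "eventually (\<lambda>i. B n * (2 / real (Suc i)) < e) sequentially"
        by (rule order_tendstoD(2)[OF null])
      then obtain i where i: "B n * (2 / real (Suc i)) < e"
        unfolding eventually_sequentially by blast
      have "dist (c k n) (c j n) < e" if "i \<le> k" "i \<le> j" for k j
      proof -
        have "dist (c k n) (c j n) \<le> B n * Lp_seminorm q ?M (\<lambda>x. f k x - f j x)"
          using lowerc by (simp add: dist_norm)
        also have "\<dots> \<le> B n * (2 / real (Suc i))" using f_dist'[OF that] by (intro mult_left_mono) (auto simp: B_def)
        finally show ?thesis using i by simp
      qed
      then show "\<exists>M. \<forall>k\<ge>M. \<forall>j\<ge>M. dist (c k n) (c j n) < e" by blast
    qed
    then show ?thesis by (simp add: Cauchy_convergent_iff convergent_def)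
  qed
  then obtain b where b: "\<And>n. (\<lambda>k. c k n) \<longlonglongrightarrow> b n" by metis
  \<comment> \<open>The rate in k is uniform in n up to the factor \<open>B n\<close>. Since the
    majorant series converges below 1, this gives pointwise convergence of the polynomials
    there.\<close>
  have b_close: "norm (c k n - b n) \<le> B n * (2 / real (Suc k))" for k n
  proof (rule tendsto_upperbound)
    show "(\<lambda>j. norm (c k n - c j n)) \<longlonglongrightarrow> norm (c k n - b n)" by (intro tendsto_intros b)
    show "\<forall>\<^sub>F j in sequentially. norm (c k n - c j n) \<le> B n * (2 / real (Suc k))"
      using eventually_ge_at_top[of k]
    proof eventually_elim
      case (elim j)
      have "B n * Lp_seminorm q ?M (\<lambda>x. f k x - f j x) \<le> B n * (2 / real (Suc k))"
        using f_dist'[of k k j] elim by (intro mult_left_mono) (auto simp: B_def)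
      with lowerc[of k n j] show ?case by simp
    qed
  qed simp
  have Beq: "B n = C powr (1 / q) * \<Lambda> n powr (1 / q)" for n
    using C \<Lambda>0[of n] by (simp add: B_def powr_mult)
  define g where "g = muntz_series \<Lambda> b"
  have g_meas: "g \<in> borel_measurable ?M"
    unfolding g_def by (intro measurable_restrict_space1 measurable_completion) simp
  have fg: "norm (f k x - g x) \<le> C powr (1 / q) * muntz_majorant \<Lambda> q x * (2 / real (Suc k))"
    if x: "0 \<le> x" "x < 1" for k x
  proof -
    define d where "d n = c k n - b n" for n
    have d: "norm (d n) \<le> C powr (1 / q) * (2 / real (Suc k)) * \<Lambda> n powr (1 / q)" for n
      using b_close[of k n] by (simp add: d_def Beq mult_ac)
    \<comment> \<open>As c - d = b, this also yields convergence of the limit series, from a finite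
      sum and a dominated remainder.\<close>
    have "(\<lambda>n. c k n * of_real (x powr \<Lambda> n) - d n * of_real (x powr \<Lambda> n)) sums (f k x - muntz_series \<Lambda> d x)"
      unfolding muntz_series_def by (intro sums_diff f_series summable_sums summable_muntz_series[OF \<Lambda> x d])
    then have "f k x - muntz_series \<Lambda> d x = g x"
      unfolding g_def muntz_series_def by (simp add: sums_iff d_def algebra_simps)
    then have "f k x - g x = muntz_series \<Lambda> d x" by (simp add: algebra_simps)
    with norm_muntz_series_le[OF \<Lambda> x d] show ?thesis by (simp add: mult_ac)
  qed
  have lim: "(\<lambda>k. f k x) \<longlonglongrightarrow> g x" if x: "0 \<le> x" "x < 1" for x
  proof -
    have "(\<lambda>k. f k x - g x) \<longlonglongrightarrow> 0"
      by (rule Lim_null_comparison[OF always_eventually null[of "C powr (1 / q) * muntz_majorant \<Lambda> q x"]])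
         (use fg[OF x] in auto)
    then show ?thesis by (simp add: LIM_zero_iff)
  qed
  have AE01: "AE x in ?M. 0 \<le> x \<and> x < 1"
  proof -
    have "AE x in lborel. x \<noteq> (1::real)" by (rule AE_lborel_singleton)
    then have "AE x in lebesgue. x \<noteq> (1::real)" by (rule AE_completion)
    then show ?thesis by (subst AE_restrict_space_iff) (auto elim: eventually_mono)
  qed
  have "(\<lambda>x. f k x - g x) \<in> Lp_functions q ?M \<and> Lp_seminorm q ?M (\<lambda>x. f k x - g x) \<le> 2 / real (Suc k)" for k
  proof -
    \<comment> \<open>Fatou in j with k fixed: the Cauchy estimate between polynomials becomes an
      estimate of the distance to g.\<close>
    have "AE x in ?M. (\<lambda>j. f k x - f (j + k) x) \<longlonglongrightarrow> f k x - g x"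
      using AE01
    proof eventually_elim
      case (elim x)
      then show ?case by (intro tendsto_intros LIMSEQ_ignore_initial_segment lim) auto
    qed
    moreover have bnd: "(\<integral>x. norm (f k x - f (j + k) x) powr q \<partial>?M) \<le> (2 / real (Suc k)) powr q" for j
      using f_dist'[of k k "j + k"] by (subst Lp_seminorm_le_iff[symmetric]) (use q in auto)
    moreover have "(\<lambda>x. f k x - g x) \<in> borel_measurable ?M"
      using Lp_functionsD(1)[OF f_Lp] g_meas by (intro borel_measurable_diff)
    ultimately have "(\<lambda>x. f k x - g x) \<in> Lp_functions q ?M \<and> (\<integral>x. norm (f k x - g x) powr q \<partial>?M) \<le> (2 / real (Suc k)) powr q"
      using Lp_functions_Fatou[OF q0, of "\<lambda>j x. f k x - f (j + k) x"] Lp_functions_diff[OF q f_Lp f_Lp] by blast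
    then show ?thesis by (subst Lp_seminorm_le_iff) (use q in auto)
  qed
  note fgLp = this
  have gLp: "g \<in> Lp_functions q ?M"
    using Lp_functions_diff[OF q f_Lp[of 0] conjunct1[OF fgLp[of 0]]] by simp
  have "Lp_seminorm q ?M (\<lambda>x. f0 x - g x) \<le> 2 * (2 / real (Suc k))" for k
  proof -
    have "1 / real (Suc k) \<le> 2 / real (Suc k)" by (intro divide_right_mono) auto
    then show ?thesis
      using Lp_seminorm_diff_triangle[OF q f0(1) f_Lp[of k] gLp] f_close[of k] fgLp[of k] by simp
  qed
  then have "Lp_seminorm q ?M (\<lambda>x. f0 x - g x) \<le> 0"
    by (intro tendsto_lowerbound[OF null[of 2] always_eventually]) auto
  then have "Lp_seminorm q ?M (\<lambda>x. f0 x - g x) = 0" using Lp_seminorm_nonneg by (rule antisym)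
  then have "AE x in ?M. f0 x - g x = 0"
    using Lp_seminorm_eq_0[OF q Lp_functions_diff[OF q f0(1) gLp]] by simp
  then have gF: "g \<in> F" using gLp f0(2) by (auto simp: Lp_class_def elim: eventually_mono)
  have "(\<Sum>n<M. norm (b n) powr q / \<Lambda> n) \<le> C * Lp_seminorm q ?M f0 powr q" for M
  proof (rule LIMSEQ_le)
    show "(\<lambda>k. \<Sum>n<M. norm (c k n) powr q / \<Lambda> n) \<longlonglongrightarrow> (\<Sum>n<M. norm (b n) powr q / \<Lambda> n)"
      using q0 \<Lambda>0 by (intro tendsto_sum tendsto_divide tendsto_powr' tendsto_norm b tendsto_const)
        (auto simp: less_imp_neq[symmetric])
    have "(\<lambda>k. Lp_seminorm q ?M f0 + 1 * (2 / real (Suc k))) \<longlonglongrightarrow> Lp_seminorm q ?M f0 + 0"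
      by (intro tendsto_add tendsto_const null)
    then show "(\<lambda>k. C * (Lp_seminorm q ?M f0 + 1 * (2 / real (Suc k))) powr q) \<longlonglongrightarrow> C * Lp_seminorm q ?M f0 powr q"
      using q0 Lp_seminorm_nonneg[of q ?M f0] by (intro tendsto_mult_left tendsto_powr') auto
    have "(\<Sum>n<M. norm (c k n) powr q / \<Lambda> n) \<le> C * (Lp_seminorm q ?M f0 + 1 * (2 / real (Suc k))) powr q" for k
    proof -
      have "Lp_seminorm q ?M (f k) \<le> Lp_seminorm q ?M f0 + Lp_seminorm q ?M (\<lambda>x. f k x - f0 x)"
        using Lp_seminorm_triangle[OF q f0(1) Lp_functions_diff[OF q f_Lp[of k] f0(1)]] by simp
      also have "Lp_seminorm q ?M (\<lambda>x. f k x - f0 x) \<le> 1 / real (Suc k)"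
        using f_close[of k] Lp_seminorm_minus_commute[of q ?M "f k" f0] by simp
      also have "\<dots> \<le> 1 * (2 / real (Suc k))" by (simp add: divide_right_mono)
      finally have "C * Lp_seminorm q ?M (f k) powr q \<le> C * (Lp_seminorm q ?M f0 + 1 * (2 / real (Suc k))) powr q"
        using C q Lp_seminorm_nonneg[of q ?M "f k"] by (intro mult_left_mono powr_mono2) auto
      with lowerf[of k M] show ?thesis by simp
    qed
    then show "\<exists>K. \<forall>k\<ge>K. (\<Sum>n<M. norm (c k n) powr q / \<Lambda> n) \<le> C * (Lp_seminorm q ?M f0 + 1 * (2 / real (Suc k))) powr q"
      by blast
  qed
  then show thesis
    by (intro that[of b]) (use gF Lp_norm_class[OF f0(1)] f0(2) in \<open>simp_all add: g_def\<close>)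
qed

section \<open>Uniqueness of the coefficients\<close>

text \<open>Intervals (0,\<delta>) have positive measure, so an almost sure property cannot fail on
  all of one.\<close>

lemma AE_lebesgue_on_01_near_0:
  assumes "AE x in lebesgue_on {0..1::real}. P x" and \<epsilon>: "0 < \<epsilon>"
  obtains x where "0 < x" "x < \<epsilon>" "P x"
proof -
  define \<delta> where "\<delta> = min \<epsilon> 1"
  have \<delta>: "0 < \<delta>" "\<delta> \<le> \<epsilon>" "\<delta> \<le> 1" using \<epsilon> by (auto simp: \<delta>_def)
  have AE: "AE x in lebesgue. x \<in> {0..1} \<longrightarrow> P x"
    using assms(1) by (subst (asm) AE_restrict_space_iff) auto
  have "\<exists>x. 0 < x \<and> x < \<delta> \<and> P x"
  proof (rule ccontr)
    assume "\<not> ?thesis"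
    then have "AE x in lebesgue. x \<notin> {0<..<\<delta>}"
      using AE \<delta> by (auto elim!: eventually_mono)
    then have "{0<..<\<delta>} \<in> null_sets lebesgue"
      by (subst AE_iff_null_sets) auto
    then have "emeasure lebesgue {0<..<\<delta>} = 0" by auto
    then show False using \<delta> by simp
  qed
  then show thesis using that \<delta> by force
qed

text \<open>Divide by the first nonvanishing term and let \<open>x\<close> tend to 0.\<close>

lemma muntz_series_AE_0_imp_0:
  fixes a :: "nat \<Rightarrow> 'a::{real_normed_field, euclidean_space}"
  assumes \<Lambda>: "lacunary \<Lambda>"
    and sm: "\<And>x. 0 \<le> x \<Longrightarrow> x < 1 \<Longrightarrow> summable (\<lambda>n. a n * of_real (x powr \<Lambda> n))"
    and AE: "AE x in lebesgue_on {0..1}. x < 1 \<longrightarrow> (\<Sum>n. a n * of_real (x powr \<Lambda> n)) = 0"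
  shows "a n = 0"
proof (induction n rule: less_induct)
  case (less n)
  have \<Lambda>0: "0 < \<Lambda> n" "\<Lambda> n < \<Lambda> (Suc n)" for n
  proof -
    obtain r where r: "1 < r" "\<And>n. 0 < \<Lambda> n" "\<And>n. r * \<Lambda> n \<le> \<Lambda> (Suc n)"
      using lacunaryE[OF \<Lambda>] by blast
    show "0 < \<Lambda> n" by (rule r)
    have "1 * \<Lambda> n < r * \<Lambda> n" using r(1) r(2)[of n] by (intro mult_strict_right_mono)
    then show "\<Lambda> n < \<Lambda> (Suc n)" using r(3)[of n] by simp
  qed
  \<comment> \<open>Convergence at the single point 1 / 2 already gives an exponential bound on all
    coefficients.\<close>
  have "(\<lambda>m. a m * of_real ((1 / 2) powr \<Lambda> m)) \<longlonglongrightarrow> 0"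
    by (rule summable_LIMSEQ_zero, rule sm) auto
  then have "Bseq (\<lambda>m. a m * of_real ((1 / 2) powr \<Lambda> m))"
    by (intro convergent_imp_Bseq convergentI)
  then obtain B where B: "0 < B" "\<And>m. norm (a m * of_real ((1 / 2) powr \<Lambda> m)) \<le> B"
    unfolding Bseq_def by auto
  define S where "S = (\<Sum>m. (1 / 2) powr (\<Lambda> (m + Suc n) - \<Lambda> (Suc n)))"
  have Ssum: "summable (\<lambda>m. (1 / 2) powr (\<Lambda> (m + Suc n) - \<Lambda> (Suc n)) :: real)"
  proof -
    have "summable (\<lambda>m. \<Lambda> m powr 0 * (1 / 2) powr \<Lambda> m)"
      by (rule summable_lacunary_powr[OF \<Lambda>]) auto
    then have "summable (\<lambda>m. (1 / 2 :: real) powr \<Lambda> m)" using \<Lambda>0(1) by (simp add: less_imp_neq[symmetric])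
    then have "summable (\<lambda>m. (1 / 2 :: real) powr \<Lambda> (m + Suc n))" by (subst summable_iff_shift)
    from summable_divide[OF this, of "(1 / 2) powr \<Lambda> (Suc n)"] show ?thesis by (simp add: powr_diff)
  qed
  have key: "norm (a n) * (1 / 2) powr \<Lambda> n \<le> B * S * (2 * x) powr (\<Lambda> (Suc n) - \<Lambda> n)"
    if x: "0 < x" "x < 1 / 4" and zero: "(\<Sum>m. a m * of_real (x powr \<Lambda> m)) = 0" for x
  proof -
    \<comment> \<open>Measuring x relative to 1 / 2 makes the coefficient bound B applicable; x < 1
      / 4 keeps y below 1 / 2, so the tail is dominated by S times the leading power of y.\<close>
    define y where "y = 2 * x"
    have y: "0 < y" "y \<le> 1 / 2" "x = 1 / 2 * y" using x by (auto simp: y_def)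
    have xp: "x powr c = (1 / 2) powr c * y powr c" for c
      using y by (simp only: powr_mult)
    have xt: "norm (a m * of_real (x powr \<Lambda> m)) = norm (a m * of_real ((1 / 2) powr \<Lambda> m)) * y powr \<Lambda> m" for m
      unfolding xp by (simp add: norm_mult)
    let ?t = "\<lambda>m. a m * of_real (x powr \<Lambda> m)"
    have smx: "summable ?t" using x by (intro sm) auto
    have "0 = (\<Sum>m. ?t (m + Suc n)) + (\<Sum>m<Suc n. ?t m)"
      using suminf_split_initial_segment[OF smx, of "Suc n"] zero by simp
    also have "(\<Sum>m<Suc n. ?t m) = ?t n" using less by simp
    finally have "?t n = - (\<Sum>m. ?t (m + Suc n))"
      by (simp only: eq_neg_iff_add_eq_0 add.commute)
    then have "norm (?t n) = norm (\<Sum>m. ?t (m + Suc n))"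
      by (simp only: norm_minus_cancel)
    also have "\<dots> \<le> (\<Sum>m. B * (y powr \<Lambda> (Suc n) * (1 / 2) powr (\<Lambda> (m + Suc n) - \<Lambda> (Suc n))))"
    proof (rule norm_suminf_le)
      show "summable (\<lambda>m. B * (y powr \<Lambda> (Suc n) * (1 / 2) powr (\<Lambda> (m + Suc n) - \<Lambda> (Suc n))))"
        by (intro summable_mult Ssum)
      fix m
      have "norm (?t (m + Suc n)) = norm (a (m + Suc n) * of_real ((1 / 2) powr \<Lambda> (m + Suc n))) * y powr \<Lambda> (m + Suc n)"
        by (rule xt)
      also have "\<dots> \<le> B * y powr \<Lambda> (m + Suc n)" by (intro mult_right_mono B) auto
      also have "y powr \<Lambda> (m + Suc n) = y powr \<Lambda> (Suc n) * y powr (\<Lambda> (m + Suc n) - \<Lambda> (Suc n))"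
        by (simp flip: powr_add)
      also have "y powr (\<Lambda> (m + Suc n) - \<Lambda> (Suc n)) \<le> (1 / 2) powr (\<Lambda> (m + Suc n) - \<Lambda> (Suc n))"
        using y lacunary_mono[OF \<Lambda>, of "Suc n" "m + Suc n"] by (intro powr_mono2) auto
      finally show "norm (?t (m + Suc n)) \<le> B * (y powr \<Lambda> (Suc n) * (1 / 2) powr (\<Lambda> (m + Suc n) - \<Lambda> (Suc n)))"
        using B by (simp add: mult_left_mono)
    qed
    also have "\<dots> = B * (y powr \<Lambda> (Suc n) * S)"
      unfolding S_def using Ssum by (simp add: suminf_mult summable_mult)
    finally have "norm (a n) * (1 / 2) powr \<Lambda> n * y powr \<Lambda> n \<le> B * S * y powr (\<Lambda> (Suc n) - \<Lambda> n) * y powr \<Lambda> n"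
    proof -
      assume *: "norm (?t n) \<le> B * (y powr \<Lambda> (Suc n) * S)"
      have eq1: "norm (?t n) = norm (a n) * (1 / 2) powr \<Lambda> n * y powr \<Lambda> n"
        unfolding xt by (simp add: norm_mult)
      have eq2: "y powr \<Lambda> (Suc n) = y powr (\<Lambda> (Suc n) - \<Lambda> n) * y powr \<Lambda> n"
        by (simp flip: powr_add)
      show ?thesis using * unfolding eq1 eq2 by (simp only: mult_ac)
    qed
    then show ?thesis using y(1) unfolding y_def[symmetric] by simp
  qed
  show "a n = 0"
  proof (rule ccontr)
    assume "a n \<noteq> 0"
    then have pos: "0 < norm (a n) * (1 / 2) powr \<Lambda> n" by simp
    define d where "d = \<Lambda> (Suc n) - \<Lambda> n"
    have d: "0 < d" using \<Lambda>0 by (simp add: d_def)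
    have "((\<lambda>x. B * S * (2 * x) powr d) \<longlongrightarrow> 0) (at_right 0)" using d by real_asymp
    then have "eventually (\<lambda>x. B * S * (2 * x) powr d < norm (a n) * (1 / 2) powr \<Lambda> n) (at_right 0)"
      using pos by (rule order_tendstoD)
    then obtain \<epsilon> where \<epsilon>: "0 < \<epsilon>" "\<And>x. 0 < x \<Longrightarrow> x < \<epsilon> \<Longrightarrow> B * S * (2 * x) powr d < norm (a n) * (1 / 2) powr \<Lambda> n"
      unfolding eventually_at_right_field by auto
    obtain x where x: "0 < x" "x < min \<epsilon> (1 / 4)" "x < 1 \<longrightarrow> (\<Sum>n. a n * of_real (x powr \<Lambda> n)) = 0"
      by (rule AE_lebesgue_on_01_near_0[OF AE, of "min \<epsilon> (1 / 4)"]) (use \<epsilon> in auto)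
    show False using key[of x] x \<epsilon>(2)[of x] by (simp add: d_def)
  qed
qed

text \<open>Two series in the same class agree almost everywhere, so their difference has only zero
  coefficients and the definite description is determined.\<close>

lemma muntz_coeffs_eqI:
  fixes F :: "(real \<Rightarrow> 'a::{real_normed_field, euclidean_space}) set"
  assumes \<Lambda>: "lacunary \<Lambda>" and F: "F \<in> Lp_space q (lebesgue_on {0..1})"
    and sm: "\<And>x. 0 \<le> x \<Longrightarrow> x < 1 \<Longrightarrow> summable (\<lambda>n. a n * of_real (x powr \<Lambda> n))"
    and a: "muntz_series \<Lambda> a \<in> F"
  shows "muntz_coeffs \<Lambda> F = a"
  unfolding muntz_coeffs_def
proof (rule the_equality)
  show "(\<forall>x\<in>{0..<1}. summable (\<lambda>n. a n * of_real (x powr \<Lambda> n))) \<and> (\<lambda>x. \<Sum>n. a n * of_real (x powr \<Lambda> n)) \<in> F"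
    using sm a by (auto simp: muntz_series_def[abs_def])
  fix b assume b: "(\<forall>x\<in>{0..<1}. summable (\<lambda>n. b n * of_real (x powr \<Lambda> n))) \<and> (\<lambda>x. \<Sum>n. b n * of_real (x powr \<Lambda> n)) \<in> F"
  obtain f where f: "F = Lp_class q (lebesgue_on {0..1}) f" using F by (auto simp: Lp_space_def)
  have "b n - a n = 0" for n
  proof (rule muntz_series_AE_0_imp_0[OF \<Lambda>])
    show "summable (\<lambda>n. (b n - a n) * of_real (x powr \<Lambda> n))" if "0 \<le> x" "x < 1" for x
      using summable_diff[OF _ sm[OF that], of "\<lambda>n. b n * of_real (x powr \<Lambda> n)"] b that by (simp add: left_diff_distrib)
    have "AE x in lebesgue_on {0..1}. muntz_series \<Lambda> a x = f x" "AE x in lebesgue_on {0..1}. muntz_series \<Lambda> b x = f x"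
      using a b f by (auto simp: Lp_class_def muntz_series_def[abs_def])
    then have "AE x in lebesgue_on {0..1}. muntz_series \<Lambda> b x = muntz_series \<Lambda> a x" by eventually_elim simp
    moreover have "AE x in lebesgue_on {0..1}. 0 \<le> x \<and> x \<le> (1::real)" by (rule AE_I2) auto
    ultimately show "AE x in lebesgue_on {0..1}. x < 1 \<longrightarrow> (\<Sum>n. (b n - a n) * of_real (x powr \<Lambda> n)) = 0"
    proof eventually_elim
      case (elim x)
      show ?case
      proof
        assume "x < 1"
        with elim(2) have x: "0 \<le> x" "x < 1" by auto
        then have "summable (\<lambda>n. b n * of_real (x powr \<Lambda> n))" using b by auto
        from suminf_diff[OF this sm[OF x]] elim(1)
        show "(\<Sum>n. (b n - a n) * of_real (x powr \<Lambda> n)) = 0" by (simp add: left_diff_distrib muntz_series_def)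
      qed
    qed
  qed
  then show "b = a" by auto
qed

section \<open>Compactness\<close>

text \<open>The partial sums are dominated by those with coefficients \<open>norm (a n)\<close>,
  whose norms are bounded uniformly in N. The growth bound on a gives pointwise convergence, and
  Fatou passes to the series.\<close>

lemma muntz_series_Lp:
  fixes a :: "nat \<Rightarrow> 'a::{real_normed_field, euclidean_space}"
  assumes \<Lambda>: "lacunary \<Lambda>" and q: "1 \<le> q" and \<mu>: "sets \<mu> = sets (restrict_space borel {0..<1::real})"
    and C: "0 \<le> C" "\<And>b N. (\<And>n. 0 \<le> b n) \<Longrightarrow> integrable \<mu> (\<lambda>t. (\<Sum>n<N. b n * t powr \<Lambda> n) powr q) \<and>
      (\<integral>t. (\<Sum>n<N. b n * t powr \<Lambda> n) powr q \<partial>\<mu>) \<le> C * (\<Sum>n<N. b n powr q / \<Lambda> n * e n)"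
    and a: "\<And>n. norm (a n) \<le> B * \<Lambda> n powr (1 / q)"
    and D: "\<And>N. (\<Sum>n<N. norm (a n) powr q / \<Lambda> n * e n) \<le> D"
  shows "muntz_series \<Lambda> a \<in> Lp_functions q \<mu>"
    and "(\<integral>t. norm (muntz_series \<Lambda> a t) powr q \<partial>\<mu>) \<le> C * D"
proof -
  define f where "f N t = (\<Sum>n<N. a n * of_real (t powr \<Lambda> n))" for N t
  have q0: "0 < q" using q by simp
  have f_meas: "f N \<in> borel_measurable \<mu>" for N
    unfolding f_def[abs_def] by (intro borel_measurable_01[OF \<mu>]) measurable
  have le: "norm (f N t) powr q \<le> (\<Sum>n<N. norm (a n) * t powr \<Lambda> n) powr q" for N t
    unfolding f_def using q0
    by (intro powr_mono2 order.trans[OF norm_sum] sum_mono) (auto simp: norm_mult)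
  have int: "integrable \<mu> (\<lambda>t. norm (f N t) powr q)" for N
  proof (rule Bochner_Integration.integrable_bound)
    show "integrable \<mu> (\<lambda>t. (\<Sum>n<N. norm (a n) * t powr \<Lambda> n) powr q)" using C(2) by auto
    show "(\<lambda>t. norm (f N t) powr q) \<in> borel_measurable \<mu>" using f_meas by measurable
    show "AE t in \<mu>. norm (norm (f N t) powr q) \<le> norm ((\<Sum>n<N. norm (a n) * t powr \<Lambda> n) powr q)"
      using le by (intro AE_I2) (auto intro: order.trans[OF _ abs_ge_self])
  qed
  have bound: "(\<integral>t. norm (f N t) powr q \<partial>\<mu>) \<le> C * D" for N
  proof -
    have "(\<integral>t. norm (f N t) powr q \<partial>\<mu>) \<le> (\<integral>t. (\<Sum>n<N. norm (a n) * t powr \<Lambda> n) powr q \<partial>\<mu>)"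
      using C(2)[of "\<lambda>n. norm (a n)" N] by (intro integral_mono int le) auto
    also have "\<dots> \<le> C * (\<Sum>n<N. norm (a n) powr q / \<Lambda> n * e n)"
      using C(2)[of "\<lambda>n. norm (a n)" N] by auto
    also have "\<dots> \<le> C * D" by (intro mult_left_mono D C)
    finally show ?thesis .
  qed
  have lim: "AE t in \<mu>. (\<lambda>N. f N t) \<longlonglongrightarrow> muntz_series \<Lambda> a t"
  proof (rule AE_I2)
    fix t assume "t \<in> space \<mu>"
    then have t: "0 \<le> t" "t < 1" by (auto simp: space_01[OF \<mu>])
    show "(\<lambda>N. f N t) \<longlonglongrightarrow> muntz_series \<Lambda> a t"
      unfolding f_def muntz_series_def by (intro summable_LIMSEQ summable_muntz_series[OF \<Lambda> t a])
  qed
  have f: "f N \<in> Lp_functions q \<mu>" for N using f_meas int by (simp add: Lp_functions_def)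
  have g: "muntz_series \<Lambda> a \<in> borel_measurable \<mu>" by (intro borel_measurable_01[OF \<mu>]) simp
  show "muntz_series \<Lambda> a \<in> Lp_functions q \<mu>" "(\<integral>t. norm (muntz_series \<Lambda> a t) powr q \<partial>\<mu>) \<le> C * D"
    using Lp_functions_Fatou[OF q0 f g lim bound] by auto
qed

section \<open>Balls in the weighted sequence space\<close>

text \<open>D bounds the q-th power of the weighted l^q norm. Bounding all partial sums expresses
  convergence and the bound together, and survives coordinatewise limits.\<close>

definition coeff_ball :: "(nat \<Rightarrow> real) \<Rightarrow> real \<Rightarrow> real \<Rightarrow> (nat \<Rightarrow> 'a::real_normed_vector) set" where
  "coeff_ball \<Lambda> q D = {a. \<forall>N. (\<Sum>n<N. norm (a n) powr q / \<Lambda> n) \<le> D}"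

lemma coeff_ball_norm_le:
  assumes \<Lambda>: "\<And>n. 0 < \<Lambda> n" and q: "0 < q" and a: "a \<in> coeff_ball \<Lambda> q D"
  shows "norm (a n) \<le> D powr (1 / q) * \<Lambda> n powr (1 / q)"
proof -
  have "norm (a n) powr q / \<Lambda> n \<le> (\<Sum>k<Suc n. norm (a k) powr q / \<Lambda> k)"
    using \<Lambda> by (intro member_le_sum) (auto simp: less_imp_le)
  also have "\<dots> \<le> D" using a unfolding coeff_ball_def by blast
  finally have le: "norm (a n) powr q \<le> D * \<Lambda> n" using \<Lambda>[of n] by (simp add: field_simps)
  then have D: "0 \<le> D" using \<Lambda>[of n] by (metis order.trans powr_ge_zero zero_le_mult_iff not_le order_less_imp_le)
  have "(norm (a n) powr q) powr (1 / q) \<le> (D * \<Lambda> n) powr (1 / q)"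
    using le q by (intro powr_mono2) auto
  then show ?thesis using q D \<Lambda>[of n] by (simp add: powr_powr powr_mult)
qed

lemma coeff_ball_diff:
  assumes \<Lambda>: "\<And>n. 0 < \<Lambda> n" and q: "0 < q" and a: "a \<in> coeff_ball \<Lambda> q D" and b: "b \<in> coeff_ball \<Lambda> q D"
  shows "(\<lambda>n. a n - b n) \<in> coeff_ball \<Lambda> q (2 powr q * (2 * D))"
  unfolding coeff_ball_def
proof safe
  fix N
  have "norm (a n - b n) powr q / \<Lambda> n \<le> 2 powr q * (norm (a n) powr q / \<Lambda> n + norm (b n) powr q / \<Lambda> n)" for n
  proof -
    have "norm (a n - b n) powr q \<le> (norm (a n) + norm (b n)) powr q"
      using q by (intro powr_mono2 norm_triangle_ineq4) auto
    also have "\<dots> \<le> 2 powr q * (norm (a n) powr q + norm (b n) powr q)"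
      by (intro add_powr_le q) auto
    finally have "norm (a n - b n) powr q / \<Lambda> n \<le> 2 powr q * (norm (a n) powr q + norm (b n) powr q) / \<Lambda> n"
      using \<Lambda>[of n] by (intro divide_right_mono) auto
    then show ?thesis by (simp add: add_divide_distrib distrib_left)
  qed
  then have "(\<Sum>n<N. norm (a n - b n) powr q / \<Lambda> n)
      \<le> (\<Sum>n<N. 2 powr q * (norm (a n) powr q / \<Lambda> n + norm (b n) powr q / \<Lambda> n))"
    by (intro sum_mono)
  also have "\<dots> = 2 powr q * ((\<Sum>n<N. norm (a n) powr q / \<Lambda> n) + (\<Sum>n<N. norm (b n) powr q / \<Lambda> n))"
    by (simp add: sum_distrib_left sum.distrib distrib_left)
  also have "\<dots> \<le> 2 powr q * (D + D)"
    using a b unfolding coeff_ball_def by (intro mult_left_mono add_mono) auto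
  finally show "(\<Sum>n<N. norm (a n - b n) powr q / \<Lambda> n) \<le> 2 powr q * (2 * D)" by simp
qed

text \<open>The ball lies in a product of closed balls of a finite-dimensional space, compact by
  Tychonoff. The countable product is metrizable, so subsequences exist; each bound involves
  finitely many coordinates and passes to the limit.\<close>

lemma coeff_ball_seq_compact:
  fixes \<alpha> :: "nat \<Rightarrow> nat \<Rightarrow> 'a::euclidean_space"
  assumes \<Lambda>: "\<And>n. 0 < \<Lambda> n" and q: "0 < q" and \<alpha>: "\<And>k. \<alpha> k \<in> coeff_ball \<Lambda> q D"
  obtains b r where "b \<in> coeff_ball \<Lambda> q D" "strict_mono r" "\<And>n. (\<lambda>k. \<alpha> (r k) n) \<longlonglongrightarrow> b n"
proof -
  define R where "R n = D powr (1 / q) * \<Lambda> n powr (1 / q)" for n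
  have "compactin (product_topology (\<lambda>_. euclidean) UNIV) (PiE UNIV (\<lambda>n. cball (0::'a) (R n)))"
    by (subst compactin_PiE) auto
  then have "compact (PiE UNIV (\<lambda>n. cball (0::'a) (R n)))"
    by (simp add: euclidean_product_topology)
  then have "seq_compact (PiE UNIV (\<lambda>n. cball (0::'a) (R n)))"
    by (simp add: compact_eq_seq_compact_metric)
  moreover have "\<alpha> k \<in> PiE UNIV (\<lambda>n. cball 0 (R n))" for k
    using coeff_ball_norm_le[OF \<Lambda> q \<alpha>] by (auto simp: R_def)
  ultimately obtain b r where br: "strict_mono r" "(\<alpha> \<circ> r) \<longlonglongrightarrow> b"
    by (meson seq_compactE)
  have lim: "(\<lambda>k. \<alpha> (r k) n) \<longlonglongrightarrow> b n" for n
    using continuous_on_tendsto_compose[OF continuous_on_product_coordinates[of n] br(2)] by (simp add: o_def)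
  have "(\<Sum>n<N. norm (b n) powr q / \<Lambda> n) \<le> D" for N
  proof (rule LIMSEQ_le_const2)
    show "(\<lambda>k. \<Sum>n<N. norm (\<alpha> (r k) n) powr q / \<Lambda> n) \<longlonglongrightarrow> (\<Sum>n<N. norm (b n) powr q / \<Lambda> n)"
      using q \<Lambda> by (intro tendsto_sum tendsto_divide tendsto_powr' tendsto_norm lim tendsto_const)
        (auto simp: less_imp_neq[symmetric])
    show "\<exists>K. \<forall>k\<ge>K. (\<Sum>n<N. norm (\<alpha> (r k) n) powr q / \<Lambda> n) \<le> D"
      using \<alpha> by (auto simp: coeff_ball_def)
  qed
  then show thesis using that br(1) lim by (auto simp: coeff_ball_def)
qed

text \<open>Tail suprema of the absolute values: taking absolute values makes e nonnegative, and
  passing to tails makes it decreasing.\<close>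

lemma decreasing_majorant:
  fixes f :: "nat \<Rightarrow> real"
  assumes f: "f \<longlonglongrightarrow> 0"
  obtains e where "\<And>n m. n \<le> m \<Longrightarrow> f m \<le> e n" "e \<longlonglongrightarrow> 0" "\<And>n m. n \<le> m \<Longrightarrow> e m \<le> e n" "\<And>n. 0 \<le> e n"
proof -
  define e where "e n = (SUP m\<in>{n..}. \<bar>f m\<bar>)" for n
  have "Bseq f" using f by (intro convergent_imp_Bseq convergentI)
  then obtain K where "\<And>m. \<bar>f m\<bar> \<le> K" unfolding Bseq_def by auto
  then have bdd: "bdd_above ((\<lambda>m. \<bar>f m\<bar>) ` A)" for A by (intro bdd_aboveI[of _ K]) auto
  have le: "\<bar>f m\<bar> \<le> e n" if "n \<le> m" for n m
    unfolding e_def using that by (intro cSUP_upper bdd) auto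
  show thesis
  proof (rule that)
    show "f m \<le> e n" if "n \<le> m" for n m using le[OF that] by simp
    show nonneg: "0 \<le> e n" for n using le[of n n] by simp
    show "e m \<le> e n" if "n \<le> m" for n m
      unfolding e_def using that by (intro cSUP_subset_mono bdd) auto
    show "e \<longlonglongrightarrow> 0"
    proof (rule LIMSEQ_I)
      fix \<epsilon> :: real assume "0 < \<epsilon>"
      then obtain N where N: "\<And>m. N \<le> m \<Longrightarrow> \<bar>f m\<bar> < \<epsilon> / 2" using LIMSEQ_D[OF f, of "\<epsilon> / 2"] by auto
      have "e n \<le> \<epsilon> / 2" if "N \<le> n" for n
        unfolding e_def using N that by (intro cSUP_least) (auto intro!: less_imp_le)
      then show "\<exists>N. \<forall>n\<ge>N. norm (e n - 0) < \<epsilon>" using nonneg \<open>0 < \<epsilon>\<close> by (intro exI[of _ N]) fastforce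
    qed
  qed
qed

lemma muntz_space_subset_Lp_space:
  assumes "1 \<le> q" "F \<in> muntz_space \<Lambda> q"
  shows "F \<in> Lp_space q (lebesgue_on {0..1})"
  using assms Metric_space.topspace_mtopology[OF Metric_space_Lp[OF assms(1)]]
  unfolding muntz_space_def Lp_topology_def by (auto dest: subsetD[OF closure_of_subset_topspace])

theorem theorem5p6:
  fixes \<Lambda> :: "nat \<Rightarrow> real" and \<mu> :: "real measure" and p q :: real
  assumes "lacunary \<Lambda>"
    and "finite_measure \<mu>" and "sets \<mu> = sets (restrict_space borel {0..<1})"
    and "1 \<le> p" and "condition_b \<Lambda> \<mu> p"
    and "p < q"
  shows "compact_Lp_operator
           (muntz_space \<Lambda> q :: (real \<Rightarrow> 'a::{real_normed_field, euclidean_space}) set set)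
           q (lebesgue_on {0..1}) q \<mu> (muntz_embedding \<Lambda> q \<mu>)"
proof -
  note \<Lambda> = assms(1) and \<mu> = assms(3)
  let ?M = "lebesgue_on {0..1::real}"
  let ?X = "muntz_space \<Lambda> q :: (real \<Rightarrow> 'a) set set"
  have q: "1 \<le> q" "0 < q" using assms by auto
  obtain r where r: "1 < r" "\<And>n. 0 < \<Lambda> n" "\<And>n. r * \<Lambda> n \<le> \<Lambda> (Suc n)"
    using lacunaryE[OF \<Lambda>] by blast
  obtain e where e: "\<And>n m. n \<le> m \<Longrightarrow> \<Lambda> m * (\<integral>t. t powr (p * \<Lambda> m) \<partial>\<mu>) \<le> e n" "e \<longlonglongrightarrow> 0"
      "\<And>n m. n \<le> m \<Longrightarrow> e m \<le> e n" "\<And>n. 0 \<le> e n"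
    using decreasing_majorant[OF assms(5)[unfolded condition_b_def]] by blast
  obtain C where C: "0 \<le> C" "\<And>b N. (\<And>n. 0 \<le> b n) \<Longrightarrow> integrable \<mu> (\<lambda>t. (\<Sum>n<N. b n * t powr \<Lambda> n) powr q) \<and>
      (\<integral>t. (\<Sum>n<N. b n * t powr \<Lambda> n) powr q \<partial>\<mu>) \<le> C * (\<Sum>n<N. b n powr q / \<Lambda> n * e n)"
    using integral_lacunary_sum_powr_le[where l=\<Lambda> and p=p and q=q and e=e, OF r _ _ assms(2,3) e(1)] assms by auto
  obtain A where A: "0 \<le> A"
    "\<And>M (a :: nat \<Rightarrow> 'a). (\<Sum>n<M. norm (a n) powr q / \<Lambda> n)
       \<le> A * (\<integral>t. norm (\<Sum>m<M. a m * of_real (t powr \<Lambda> m)) powr q \<partial>lebesgue_on {0..1})"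
    using muntz_lower_bound[OF \<Lambda> q(1), where 'a='a] by blast
  \<comment> \<open>Before N the weight is bounded by \<open>e 0\<close>, leaving finitely many
    coordinates; from N on it is bounded by \<open>e N\<close>, which is small uniformly over the
    ball.\<close>
  have tail: "(\<Sum>n<M. norm (a n) powr q / \<Lambda> n * e n) \<le> e 0 * (\<Sum>n<N. norm (a n) powr q / \<Lambda> n) + e N * D"
    if a: "a \<in> coeff_ball \<Lambda> q D" for a :: "nat \<Rightarrow> 'a" and D N M
  proof -
    have "norm (a n) powr q / \<Lambda> n * e n \<le> e 0 * (if n < N then norm (a n) powr q / \<Lambda> n else 0) + e N * (norm (a n) powr q / \<Lambda> n)" for n
    proof (cases "n < N")
      case True
      have "norm (a n) powr q / \<Lambda> n * e n \<le> norm (a n) powr q / \<Lambda> n * e 0"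
        using r(2)[of n] e(3)[of 0 n] by (intro mult_left_mono) auto
      moreover have "0 \<le> e N * (norm (a n) powr q / \<Lambda> n)" using r(2)[of n] e(4)[of N] by auto
      ultimately show ?thesis using True by (simp add: mult.commute)
    next
      case False
      then have "norm (a n) powr q / \<Lambda> n * e n \<le> norm (a n) powr q / \<Lambda> n * e N"
        using r(2)[of n] e(3)[of N n] by (intro mult_left_mono) auto
      then show ?thesis using False by (simp add: mult.commute)
    qed
    then have "(\<Sum>n<M. norm (a n) powr q / \<Lambda> n * e n)
        \<le> (\<Sum>n<M. e 0 * (if n < N then norm (a n) powr q / \<Lambda> n else 0) + e N * (norm (a n) powr q / \<Lambda> n))"
      by (intro sum_mono)
    also have "\<dots> = e 0 * (\<Sum>n\<in>{..<M} \<inter> {..<N}. norm (a n) powr q / \<Lambda> n) + e N * (\<Sum>n<M. norm (a n) powr q / \<Lambda> n)"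
      unfolding sum.distrib sum_distrib_left[symmetric] sum.inter_restrict[OF finite_lessThan] lessThan_iff ..
    also have "\<dots> \<le> e 0 * (\<Sum>n<N. norm (a n) powr q / \<Lambda> n) + e N * D"
    proof (intro add_mono mult_left_mono e(4))
      show "(\<Sum>n\<in>{..<M} \<inter> {..<N}. norm (a n) powr q / \<Lambda> n) \<le> (\<Sum>n<N. norm (a n) powr q / \<Lambda> n)"
        using r(2) by (intro sum_mono2) (auto simp: less_imp_le)
      show "(\<Sum>n<M. norm (a n) powr q / \<Lambda> n) \<le> D" using a unfolding coeff_ball_def by blast
    qed
    finally show ?thesis .
  qed
  have series: "muntz_series \<Lambda> a \<in> Lp_functions q \<mu>"
      "(\<integral>t. norm (muntz_series \<Lambda> a t) powr q \<partial>\<mu>) \<le> C * (e 0 * (\<Sum>n<N. norm (a n) powr q / \<Lambda> n) + e N * D)"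
    if a: "a \<in> coeff_ball \<Lambda> q D" for a :: "nat \<Rightarrow> 'a" and D N
    using muntz_series_Lp[OF \<Lambda> q(1) \<mu> C coeff_ball_norm_le[OF r(2) q(2) a] tail[OF a]] by auto
  interpret T: Metric_space "Lp_space q \<mu> :: (real \<Rightarrow> 'a) set set" "Lp_dist q \<mu>"
    by (rule Metric_space_Lp[OF q(1)])
  \<comment> \<open>The embedding factors as the coefficient map followed by \<Phi>. The lower bound
    makes the first map bounded; the decay of e gives compactness of the second.\<close>
  define \<Phi> where "\<Phi> a = Lp_class q \<mu> (muntz_series \<Lambda> a)" for a :: "nat \<Rightarrow> 'a"
  have coeffs: "muntz_coeffs \<Lambda> F \<in> coeff_ball \<Lambda> q (A * Lp_norm q ?M F powr q)" if F: "F \<in> ?X" for F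
  proof -
    obtain a where a: "\<And>M. (\<Sum>n<M. norm (a n) powr q / \<Lambda> n) \<le> A * Lp_norm q ?M F powr q"
      "muntz_series \<Lambda> a \<in> F"
      by (rule muntz_space_series[OF \<Lambda> q(1) F A]) (rule that)
    then have ball: "a \<in> coeff_ball \<Lambda> q (A * Lp_norm q ?M F powr q)" by (simp add: coeff_ball_def)
    have "muntz_coeffs \<Lambda> F = a"
      by (intro muntz_coeffs_eqI[OF \<Lambda> muntz_space_subset_Lp_space[OF q(1) F] _ a(2)]
          summable_muntz_series[OF \<Lambda> _ _ coeff_ball_norm_le[OF r(2) q(2) ball]])
    with ball show ?thesis by simp
  qed
  have emb: "muntz_embedding \<Lambda> q \<mu> F = \<Phi> (muntz_coeffs \<Lambda> F)" for F :: "(real \<Rightarrow> 'a) set"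
    unfolding muntz_embedding_def \<Phi>_def by (simp add: muntz_value_def[abs_def] muntz_series_def[abs_def])
  have \<Phi>_in: "\<Phi> a \<in> Lp_space q \<mu>" if "a \<in> coeff_ball \<Lambda> q D" for a D
    using series(1)[OF that] by (simp add: \<Phi>_def Lp_space_def)
  have comp: "compactin T.mtopology (\<Phi> ` coeff_ball \<Lambda> q A)"
    unfolding T.compactin_sequentially
  proof (intro conjI allI impI)
    show "\<Phi> ` coeff_ball \<Lambda> q A \<subseteq> Lp_space q \<mu>" using \<Phi>_in by blast
    fix \<sigma> :: "nat \<Rightarrow> (real \<Rightarrow> 'a) set" assume "range \<sigma> \<subseteq> \<Phi> ` coeff_ball \<Lambda> q A"
    then have "\<forall>k. \<exists>a. a \<in> coeff_ball \<Lambda> q A \<and> \<sigma> k = \<Phi> a" by auto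
    from choice[OF this] obtain \<alpha> where "\<forall>k. \<alpha> k \<in> coeff_ball \<Lambda> q A \<and> \<sigma> k = \<Phi> (\<alpha> k)" ..
    then have \<alpha>: "\<And>k. \<alpha> k \<in> coeff_ball \<Lambda> q A" "\<And>k. \<sigma> k = \<Phi> (\<alpha> k)" by auto
    obtain b s where b: "b \<in> coeff_ball \<Lambda> q A" "strict_mono s" "\<And>n. (\<lambda>k. \<alpha> (s k) n) \<longlonglongrightarrow> b n"
      by (rule coeff_ball_seq_compact[where \<Lambda>=\<Lambda> and \<alpha>=\<alpha> and D=A, OF r(2) q(2) \<alpha>(1)]) (rule that)
    \<comment> \<open>The radius available for differences of two elements of the ball of radius
      A.\<close>
    define D where "D = 2 powr q * (2 * A)"
    define d where "d k n = \<alpha> (s k) n - b n" for k n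
    have d: "d k \<in> coeff_ball \<Lambda> q D" for k
      unfolding d_def[abs_def] D_def by (intro coeff_ball_diff r(2) q(2) \<alpha> b)
    define I where "I k = (\<integral>t. norm (muntz_series \<Lambda> (d k) t) powr q \<partial>\<mu>)" for k
    have I0: "0 \<le> I k" for k unfolding I_def by (intro integral_nonneg_AE) auto
    have "I \<longlonglongrightarrow> 0"
    proof (rule LIMSEQ_I)
      fix \<epsilon> :: real assume \<epsilon>: "0 < \<epsilon>"
      \<comment> \<open>The order of choices matters: N is fixed first so that the tail is small for
        every k; then the finitely many coordinates below N are made small by taking k
        large.\<close>
      have "(\<lambda>N. C * (e N * D)) \<longlonglongrightarrow> C * (0 * D)" by (intro tendsto_intros e)
      then have "eventually (\<lambda>N. C * (e N * D) < \<epsilon> / 2) sequentially"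
        using \<epsilon> by (intro order_tendstoD) auto
      then obtain N where N: "C * (e N * D) < \<epsilon> / 2" unfolding eventually_sequentially by blast
      have "(\<lambda>k. C * (e 0 * (\<Sum>n<N. norm (d k n) powr q / \<Lambda> n))) \<longlonglongrightarrow> C * (e 0 * (\<Sum>n<N. norm (b n - b n) powr q / \<Lambda> n))"
        unfolding d_def using q r(2)
        by (intro tendsto_mult tendsto_sum tendsto_divide tendsto_powr' tendsto_norm tendsto_diff b tendsto_const)
          (auto simp: less_imp_neq[symmetric])
      then have "eventually (\<lambda>k. C * (e 0 * (\<Sum>n<N. norm (d k n) powr q / \<Lambda> n)) < \<epsilon> / 2) sequentially"
        using \<epsilon> by (intro order_tendstoD) auto
      then obtain K where K: "\<And>k. K \<le> k \<Longrightarrow> C * (e 0 * (\<Sum>n<N. norm (d k n) powr q / \<Lambda> n)) < \<epsilon> / 2"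
        unfolding eventually_sequentially by blast
      have "norm (I k - 0) < \<epsilon>" if "K \<le> k" for k
        using series(2)[OF d[of k], of N] K[OF that] N I0[of k] by (simp add: I_def distrib_left)
      then show "\<exists>K. \<forall>k\<ge>K. norm (I k - 0) < \<epsilon>" by blast
    qed
    then have "(\<lambda>k. I k powr (1 / q)) \<longlonglongrightarrow> 0 powr (1 / q)"
      using q I0 by (intro tendsto_powr' tendsto_const) auto
    moreover have "Lp_dist q \<mu> (\<Phi> (\<alpha> (s k))) (\<Phi> b) = I k powr (1 / q)" for k
    proof -
      have "Lp_dist q \<mu> (\<Phi> (\<alpha> (s k))) (\<Phi> b) = Lp_seminorm q \<mu> (\<lambda>x. muntz_series \<Lambda> (\<alpha> (s k)) x - muntz_series \<Lambda> b x)"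
        unfolding \<Phi>_def by (intro Lp_dist_class series(1)[OF \<alpha>(1)] series(1)[OF b(1)])
      also have "\<dots> = I k powr (1 / q)"
      proof -
        have "muntz_series \<Lambda> (\<alpha> (s k)) x - muntz_series \<Lambda> b x = muntz_series \<Lambda> (d k) x" if "x \<in> space \<mu>" for x
        proof -
          have x: "0 \<le> x" "x < 1" using that by (auto simp: space_01[OF \<mu>])
          show ?thesis
            unfolding muntz_series_def d_def left_diff_distrib
            by (intro suminf_diff summable_muntz_series[OF \<Lambda> x coeff_ball_norm_le[OF r(2) q(2) \<alpha>(1)]]
                summable_muntz_series[OF \<Lambda> x coeff_ball_norm_le[OF r(2) q(2) b(1)]])
        qed
        then show ?thesis unfolding Lp_seminorm_def I_def
          by (intro arg_cong[where f="\<lambda>z. z powr (1 / q)"] Bochner_Integration.integral_cong) auto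
      qed
      finally show ?thesis .
    qed
    ultimately have "(\<lambda>k. Lp_dist q \<mu> ((\<sigma> \<circ> s) k) (\<Phi> b)) \<longlonglongrightarrow> 0" using q by (simp add: \<alpha>(2))
    then have "limitin T.mtopology (\<sigma> \<circ> s) (\<Phi> b) sequentially"
      unfolding T.limitin_metric_dist_null using \<Phi>_in[OF b(1)] \<Phi>_in[OF \<alpha>(1)] \<alpha>(2) by auto
    with b show "\<exists>l s. l \<in> \<Phi> ` coeff_ball \<Lambda> q A \<and> strict_mono s \<and> limitin T.mtopology (\<sigma> \<circ> s) l sequentially"
      by blast
  qed
  have sub: "muntz_embedding \<Lambda> q \<mu> ` {F \<in> ?X. Lp_norm q ?M F \<le> 1} \<subseteq> \<Phi> ` coeff_ball \<Lambda> q A"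
  proof clarify
    fix F assume F: "F \<in> ?X" "Lp_norm q ?M F \<le> 1"
    have "Lp_norm q ?M F powr q \<le> 1 powr q"
      using F q by (intro powr_mono2) (auto simp: Lp_norm_def Lp_seminorm_nonneg)
    then have "A * Lp_norm q ?M F powr q \<le> A" using A(1) by (simp add: mult_left_le)
    with coeffs[OF F(1)] have "muntz_coeffs \<Lambda> F \<in> coeff_ball \<Lambda> q A"
      unfolding coeff_ball_def by (auto intro: order.trans)
    then show "muntz_embedding \<Lambda> q \<mu> F \<in> \<Phi> ` coeff_ball \<Lambda> q A" by (auto simp: emb)
  qed
  \<comment> \<open>A compact set in a metric space is closed, so the closure of the image of the
    unit ball stays inside the compact set and inherits compactness.\<close>
  have closed: "closedin T.mtopology (\<Phi> ` coeff_ball \<Lambda> q A)"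
    using comp T.Hausdorff_space_mtopology by (rule compactin_imp_closedin[rotated])
  have "compactin T.mtopology (T.mtopology closure_of (muntz_embedding \<Lambda> q \<mu> ` {F \<in> ?X. Lp_norm q ?M F \<le> 1}))"
    by (rule closed_compactin[OF comp closure_of_minimal[OF sub closed] closedin_closure_of])
  moreover have "muntz_embedding \<Lambda> q \<mu> ` ?X \<subseteq> Lp_space q \<mu>"
    using coeffs \<Phi>_in by (auto simp: emb)
  ultimately show ?thesis by (simp add: compact_Lp_operator_def Lp_topology_def)
qed

end
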